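(* Let $\alpha_1,\ldots,\alpha_m$ be algebraic numbers of degrees $d_1,\ldots,d_m\ge 2$, respectively, and let $K=\mathbb{Q}(\alpha_1,\ldots,\alpha_m)$ have degree $d$ over $\mathbb{Q}$. Then $K$ contains an algebraic number $\alpha$ with $K=\mathbb{Q}(\alpha)$ and $$ \mathrm{h}(\alpha)\le \log (m \lfloor d/2 \rfloor)+\mathrm{h}(\alpha_1)+\cdots+\mathrm{h}(\alpha_m). $$ Equivalently, $M(\alpha)\le (m\lfloor d/2\rfloor)^d\prod_{i=1}^m M(\alpha_i)^{d/d_i}$.
   Context: For a polynomial $f(x)=a_k(x-\gamma_1)\cdots(x-\gamma_k)\in\mathbb{C}[x]$ with $a_k\neq0$, its Mahler measure is $M(f)=|a_k|\prod_{j=1}^k\max\{1,|\gamma_j|\}$. For an algebraic number $\gamma$ of degree $k$, $M(\gamma)$ is the Mahler measure of its minimal polynomial over $\mathbb{Z}$ (irreducible, coprime integer coefficients), and $\mathrm{h}(\gamma)=k^{-1}\log M(\gamma)$ is its absolute logarithmic height. *)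

theory Defs
  imports "Berlekamp_Zassenhaus.Factor_Bound"
begin

definition is_subfield :: "complex set \<Rightarrow> bool" where
  "is_subfield F \<longleftrightarrow> 0 \<in> F \<and> 1 \<in> F \<and>
     (\<forall>x\<in>F. \<forall>y\<in>F. x + y \<in> F \<and> x * y \<in> F) \<and>
     (\<forall>x\<in>F. - x \<in> F \<and> inverse x \<in> F)"

text \<open>\<open>\<rat>(S)\<close>: every subfield of the complex numbers contains \<open>\<rat>\<close>, so the rational
  numbers need not be adjoined explicitly.\<close>

definition Q_adjoin :: "complex set \<Rightarrow> complex set" where
  "Q_adjoin S = \<Inter>{F. is_subfield F \<and> S \<subseteq> F}"

lemma is_subfield_Q_adjoin: "is_subfield (Q_adjoin S)"
  unfolding Q_adjoin_def is_subfield_def by blast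

abbreviation rat_scale :: "rat \<Rightarrow> complex \<Rightarrow> complex" where
  "rat_scale q x \<equiv> of_rat q * x"

lemma vector_space_rat_scale: "vector_space rat_scale"
  by unfold_locales (simp_all add: algebra_simps of_rat_add of_rat_mult)

definition Q_degree :: "complex set \<Rightarrow> nat" where
  "Q_degree K = vector_space.dim rat_scale K"

text \<open>The minimal polynomial over \<open>\<int>\<close> is only determined up to sign; the positive leading
  coefficient makes it unique.\<close>

definition is_min_int_poly :: "int poly \<Rightarrow> complex \<Rightarrow> bool" where
  "is_min_int_poly p x \<longleftrightarrow>
     irreducible p \<and> content p = 1 \<and> lead_coeff p > 0 \<and> poly (of_int_poly p) x = 0"

definition min_int_poly :: "complex \<Rightarrow> int poly" where
  "min_int_poly x = (THE p. is_min_int_poly p x)"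

lemma ex1_is_min_int_poly:
  assumes "algebraic x"
  shows "\<exists>!p. is_min_int_poly p x"
proof (rule ex_ex1I)
  from assms obtain r :: "complex poly" where r: "\<forall>i. coeff r i \<in> \<int>" "r \<noteq> 0" "poly r x = 0"
    by (auto simp: algebraic_def)
  define q :: "int poly" where "q = map_poly (\<lambda>z. \<lfloor>Re z\<rfloor>) r"
  have q: "r = of_int_poly q"
  proof (rule poly_eqI)
    fix n
    from r(1) obtain k where "coeff r n = of_int k" by (auto elim: Ints_cases)
    then show "coeff r n = coeff (of_int_poly q) n" by (simp add: q_def coeff_map_poly)
  qed
  have q0: "q \<noteq> 0" using r q by auto
  define P where "P = prime_factorization q"
  have "normalize (prod_mset P) = normalize q"
    unfolding P_def by (rule prod_mset_prime_factorization_weak[OF q0])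
  then have "q dvd prod_mset P" by (rule associatedD2)
  then obtain v where "prod_mset P = q * v" ..
  then have "poly (of_int_poly (prod_mset P)) x = (0::complex)"
    using r q by (simp add: hom_distribs)
  moreover have "poly (of_int_poly (prod_mset M)) x = (0::complex) \<Longrightarrow>
      \<exists>p \<in># M. poly (of_int_poly p) x = (0::complex)" for M
    by (induction M) (auto simp: hom_distribs)
  ultimately obtain p where p: "p \<in># P" "poly (of_int_poly p) x = (0::complex)" by blast
  have "prime p" using p(1) by (auto simp: P_def dest: in_prime_factors_imp_prime)
  then have irr: "irreducible p" by (auto dest: prime_elem_imp_irreducible)
  then have p0: "p \<noteq> 0" by auto
  have "degree p \<noteq> 0"
  proof
    assume "degree p = 0"
    then obtain a where "p = [:a:]" by (rule degree_eq_zeroE)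
    then show False using p(2) p0 by simp
  qed
  then have c: "content p = 1"
    using irreducible_imp_primitive[OF irr] by simp
  show "\<exists>p. is_min_int_poly p x"
  proof (cases "lead_coeff p > 0")
    case True
    then show ?thesis using irr c p unfolding is_min_int_poly_def by blast
  next
    case False
    moreover have "lead_coeff p \<noteq> 0" using p0 by (rule leading_coeff_neq_0)
    ultimately have "lead_coeff p < 0" by linarith
    then have "lead_coeff (- p) > 0" by simp
    moreover have "content (- p) = 1" using content_smult[of "-1" p] c by simp
    ultimately have "is_min_int_poly (- p) x"
      using irr c p by (simp add: is_min_int_poly_def hom_distribs)
    then show ?thesis ..
  qed
next
  fix p q assume p: "is_min_int_poly p x" and q: "is_min_int_poly q x"
  note d = is_min_int_poly_def
  have ncop: "\<not> is_unit (gcd p q)"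
  proof
    assume un: "is_unit (gcd p q)"
    then have "gcd p q = 1" by (metis is_unit_gcd coprime_imp_gcd_eq_1)
    then have g: "gcd (of_int_poly p :: rat poly) (of_int_poly q) = 1"
      unfolding gcd_rat_to_gcd_int by simp
    obtain a b where ab: "a * (of_int_poly p :: rat poly) + b * of_int_poly q = 1"
      using bezout_coefficients_fst_snd[of "of_int_poly p :: rat poly" "of_int_poly q"] g
      by metis
    interpret h: map_poly_comm_ring_hom "of_rat :: rat \<Rightarrow> complex"
      by unfold_locales (simp_all add: of_rat_add of_rat_mult)
    have comp: "map_poly of_rat (of_int_poly s :: rat poly) = (of_int_poly s :: complex poly)" for s
      by (simp add: map_poly_map_poly o_def)
    have "map_poly of_rat (a * (of_int_poly p :: rat poly) + b * of_int_poly q) = (1 :: complex poly)"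
      unfolding ab by simp
    then have "map_poly of_rat a * of_int_poly p + map_poly of_rat b * of_int_poly q = (1 :: complex poly)"
      by (simp add: h.hom_add h.hom_mult comp)
    then have "poly (map_poly of_rat a * of_int_poly p + map_poly of_rat b * of_int_poly q) x
        = (1::complex)" by simp
    then show False using p q by (simp add: d)
  qed
  have "p dvd q"
    using ncop p irreducibleD'[of p "gcd p q"] by (auto simp: d)
  moreover have "q dvd p"
    using ncop q irreducibleD'[of q "gcd p q"] by (auto simp: d)
  ultimately have "normalize p = normalize q" by (rule normalization_semidom_class.associatedI)
  moreover have "normalize s = s" if "lead_coeff s > 0" for s :: "int poly"
    using that by (simp add: normalize_poly_eq_map_poly normalize_poly_def unit_factor_poly_def sgn_if)
  ultimately show "p = q" using p q by (simp add: d)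
qed

lemma is_min_int_poly_min_int_poly: "algebraic x \<Longrightarrow> is_min_int_poly (min_int_poly x) x"
  unfolding min_int_poly_def by (rule theI') (rule ex1_is_min_int_poly)

definition alg_degree :: "complex \<Rightarrow> nat" where
  "alg_degree x = degree (min_int_poly x)"

definition alg_mahler :: "complex \<Rightarrow> real" where
  "alg_mahler x = mahler_measure (min_int_poly x)"

definition log_height :: "complex \<Rightarrow> real" where
  "log_height x = ln (alg_mahler x) / real (alg_degree x)"

end

theory Submission
  imports Defs "Jordan_Normal_Form.Char_Poly" "HOL-Computational_Algebra.Polynomial_FPS"
begin

text \<open>
  Write \<open>K = \<rat>(\<theta>)\<close> and \<open>\<alpha> i = g i (\<theta>)\<close>; the embeddings of \<open>K\<close> correspond to the \<open>d\<close> roots \<open>z\<close> of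
  the minimal polynomial of \<open>\<theta>\<close> and map \<open>\<alpha> i\<close> to \<open>g i (z)\<close>. The element \<open>\<beta> = \<Sum>i. c i * \<alpha> i\<close>
  generates \<open>K\<close> as soon as the \<open>d - 1\<close> nontrivial embeddings move it. These are \<open>d - 1\<close> nonzero
  linear conditions on \<open>c\<close>, and each coordinate may take the \<open>2 * (d div 2) + 1 \<ge> d\<close> integers of
  absolute value at most \<open>d div 2\<close>, so some \<open>c\<close> meets all of them.

  For the height, the archimedean part is the triangle inequality at each \<open>z\<close>. The finite part is the
  bound \<open>a \<le> \<Prod>i. a i ^ (d / \<delta> i)\<close> between the leading coefficients of the minimal polynomials of
  \<open>\<beta>\<close> and the \<open>\<alpha> i\<close>: the product of the leading coefficient of an integer polynomial with any
  subproduct of its roots is an algebraic integer, hence multiplying \<open>\<Prod>z. (x - \<beta>(z))\<close> by the right-hand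
  side gives a polynomial whose coefficients are rational algebraic integers, hence integers.
\<close>

subsection \<open>Polynomials over a subring\<close>

text \<open>A predicate on sets, because it is applied to \<int>, to \<rat>, to the algebraic
  integers, to subfields of the complex numbers and to \<open>poly_over R\<close> itself.\<close>

definition is_subring :: "'a::comm_ring_1 set \<Rightarrow> bool" where
  "is_subring R \<longleftrightarrow> 0 \<in> R \<and> 1 \<in> R \<and>
     (\<forall>x\<in>R. \<forall>y\<in>R. x + y \<in> R \<and> x * y \<in> R) \<and> (\<forall>x\<in>R. - x \<in> R)"

lemma is_subringD:
  assumes "is_subring R"
  shows "0 \<in> R" "1 \<in> R" "x \<in> R \<Longrightarrow> - x \<in> R"
    "x \<in> R \<Longrightarrow> y \<in> R \<Longrightarrow> x + y \<in> R" "x \<in> R \<Longrightarrow> y \<in> R \<Longrightarrow> x * y \<in> R"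
    "x \<in> R \<Longrightarrow> y \<in> R \<Longrightarrow> x - y \<in> R"
proof -
  show "x - y \<in> R" if "x \<in> R" "y \<in> R"
    using assms that unfolding is_subring_def diff_conv_add_uminus by blast
qed (use assms in \<open>auto simp: is_subring_def\<close>)

lemma is_subring_sum:
  assumes "is_subring R" "\<And>i. i \<in> I \<Longrightarrow> f i \<in> R"
  shows "sum f I \<in> R"
  \<comment> \<open>For infinite \<open>I\<close> the sum is 0 by convention, and 0 lies in
    \<open>R\<close> too.\<close>
  using assms(2) by (induction I rule: infinite_finite_induct) (auto intro: is_subringD[OF assms(1)])

lemma is_subring_prod:
  assumes "is_subring R" "\<And>i. i \<in> I \<Longrightarrow> f i \<in> R"
  shows "prod f I \<in> R"
  using assms(2) by (induction I rule: infinite_finite_induct) (auto intro: is_subringD[OF assms(1)])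

lemma is_subring_power: "is_subring R \<Longrightarrow> x \<in> R \<Longrightarrow> x ^ n \<in> R"
  by (induction n) (auto intro: is_subringD)

lemma is_subring_of_nat: "is_subring R \<Longrightarrow> of_nat n \<in> R"
  by (induction n) (auto intro: is_subringD)

lemma is_subring_of_int: "is_subring R \<Longrightarrow> of_int n \<in> R"
  by (cases n) (auto intro: is_subringD is_subring_of_nat simp del: of_nat_Suc)

definition poly_over :: "'a::comm_ring_1 set \<Rightarrow> 'a poly set" where
  "poly_over R = {p. \<forall>i. coeff p i \<in> R}"

lemma poly_overI: "(\<And>i. coeff p i \<in> R) \<Longrightarrow> p \<in> poly_over R"
  by (simp add: poly_over_def)

lemma poly_overD: "p \<in> poly_over R \<Longrightarrow> coeff p i \<in> R"
  by (simp add: poly_over_def)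

lemma poly_over_mono: "R \<subseteq> S \<Longrightarrow> poly_over R \<subseteq> poly_over S"
  by (auto simp: poly_over_def)

lemma is_subring_poly_over:
  assumes "is_subring R"
  shows "is_subring (poly_over R)"
proof -
  note R = is_subringD[OF assms]
  have "coeff (p * q) i \<in> R" if "p \<in> poly_over R" "q \<in> poly_over R" for p q i
    using that unfolding coeff_mult poly_over_def by (intro is_subring_sum assms R(5)) auto
  then show ?thesis
    unfolding is_subring_def by (auto simp: poly_over_def coeff_1 R)
qed

lemma poly_over_pCons:
  assumes "is_subring R" "a \<in> R" "p \<in> poly_over R"
  shows "pCons a p \<in> poly_over R"
  using assms by (auto simp: poly_over_def coeff_pCons split: nat.split)

lemma poly_over_const: "is_subring R \<Longrightarrow> a \<in> R \<Longrightarrow> [:a:] \<in> poly_over R"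
  by (auto intro!: poly_over_pCons is_subringD is_subring_poly_over)

lemma poly_over_linear: "is_subring R \<Longrightarrow> a \<in> R \<Longrightarrow> b \<in> R \<Longrightarrow> [:a, b:] \<in> poly_over R"
  by (intro poly_over_pCons poly_over_const)

lemma poly_over_smult: "is_subring R \<Longrightarrow> a \<in> R \<Longrightarrow> p \<in> poly_over R \<Longrightarrow> Polynomial.smult a p \<in> poly_over R"
  by (auto simp: poly_over_def intro: is_subringD)

lemma poly_over_pderiv: "is_subring R \<Longrightarrow> p \<in> poly_over R \<Longrightarrow> pderiv p \<in> poly_over R"
  by (auto simp: poly_over_def coeff_pderiv intro!: is_subringD(5) is_subring_of_nat simp del: of_nat_Suc)

lemma poly_over_pcompose:
  assumes "is_subring R" "p \<in> poly_over R" "q \<in> poly_over R"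
  shows "pcompose p q \<in> poly_over R"
  using assms(2)
proof (induction p)
  case 0
  then show ?case by simp
next
  case (pCons a p)
  have "a \<in> R" "p \<in> poly_over R"
    using poly_overD[OF pCons.prems, of 0] poly_overD[OF pCons.prems, of "Suc _"]
    by (auto intro: poly_overI)
  then show ?case
    using pCons.IH assms
    by (auto simp: pcompose_pCons intro!: is_subringD is_subring_poly_over poly_over_const)
qed

lemma poly_over_of_int_poly: "is_subring R \<Longrightarrow> of_int_poly p \<in> poly_over R"
  by (auto simp: poly_over_def is_subring_of_int)

lemma poly_in_subring:
  assumes "is_subring R" "p \<in> poly_over R" "x \<in> R"
  shows "poly p x \<in> R"
  unfolding poly_altdef using assms
  by (auto intro!: is_subring_sum is_subringD(5) is_subring_power poly_overD)

text \<open>Long division divides only by the leading coefficient of \<open>q\<close>, which is 1,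
  so it never leaves \<open>R\<close>. The remainder is bounded through vanishing coefficients
  rather than its degree, so that \<open>degree q = 0\<close> correctly forces
  \<open>r = 0\<close>.\<close>

lemma poly_over_monic_division:
  assumes R: "is_subring R" and q: "q \<in> poly_over R" "lead_coeff q = 1" and "p \<in> poly_over R"
  shows "\<exists>s\<in>poly_over R. \<exists>r\<in>poly_over R. p = q * s + r \<and> (\<forall>i\<ge>degree q. coeff r i = 0)"
  using assms(4)
proof (induction p)
  case 0
  then show ?case
    by (intro bexI[of _ 0]) (auto intro: is_subringD is_subring_poly_over[OF R])
next
  case (pCons a p)
  note RX = is_subringD[OF is_subring_poly_over[OF R]]
  have a: "a \<in> R" and p: "p \<in> poly_over R"
    using poly_overD[OF pCons.prems, of 0] poly_overD[OF pCons.prems, of "Suc _"]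
    by (auto intro: poly_overI)
  obtain s r where s: "s \<in> poly_over R" and r: "r \<in> poly_over R"
    and eq: "p = q * s + r" and z: "\<forall>i\<ge>degree q. coeff r i = 0"
    using pCons.IH[OF p] by blast
  \<comment> \<open>Shifting the old remainder can raise its degree to \<open>degree q\<close> at
    most; subtracting \<open>c\<close> times the monic \<open>q\<close> removes exactly that
    coefficient.\<close>
  define c where "c = coeff (pCons a r) (degree q)"
  define r' where "r' = pCons a r - Polynomial.smult c q"
  have ar: "pCons a r \<in> poly_over R" by (rule poly_over_pCons[OF R a r])
  then have c: "c \<in> R" unfolding c_def by (rule poly_overD)
  have "coeff r' i = 0" if "i \<ge> degree q" for i
  proof (cases "i = degree q")
    case True
    then show ?thesis using q(2) by (simp add: r'_def c_def)
  next
    case False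
    with that obtain j where "i = Suc j" "j \<ge> degree q" by (cases i) auto
    then show ?thesis using z by (simp add: r'_def coeff_eq_0)
  qed
  moreover have "pCons a p = q * (pCons 0 s + [:c:]) + r'"
    by (simp add: eq r'_def algebra_simps)
  moreover have "r' \<in> poly_over R"
    unfolding r'_def by (intro RX ar poly_over_smult R c q)
  moreover have "pCons 0 s + [:c:] \<in> poly_over R"
    by (intro RX poly_over_pCons R s poly_over_const c is_subringD(1))
  ultimately show ?case by blast
qed

subsection \<open>Algebraic integers\<close>

text \<open>The \<int>-module generated by \<open>B\<close>, meant for finite \<open>B\<close>: over
  an infinite set the sum would be 0 by default.\<close>

definition int_span :: "complex set \<Rightarrow> complex set" where
  "int_span B = {\<Sum>b\<in>B. of_int (c b) * b |c. True}"

lemma int_span_sum: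
  assumes "\<And>i. i \<in> I \<Longrightarrow> f i \<in> int_span B"
  shows "sum f I \<in> int_span B"
proof -
  have 0: "0 \<in> int_span B"
    unfolding int_span_def by (auto intro!: exI[of _ "\<lambda>_. 0"])
  have add: "x + y \<in> int_span B" if xy: "x \<in> int_span B" "y \<in> int_span B" for x y
  proof -
    obtain c e where "x = (\<Sum>b\<in>B. of_int (c b) * b)" "y = (\<Sum>b\<in>B. of_int (e b) * b)"
      using xy by (auto simp: int_span_def)
    then have "x + y = (\<Sum>b\<in>B. of_int (c b + e b) * b)"
      by (simp add: sum.distrib algebra_simps)
    then show ?thesis unfolding int_span_def by (auto intro: exI[of _ "\<lambda>b. c b + e b"])
  qed
  show ?thesis
    using assms by (induction I rule: infinite_finite_induct) (auto intro: 0 add)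
qed

lemma int_span_scale:
  assumes "finite B" "b \<in> B"
  shows "of_int n * b \<in> int_span B"
proof -
  have "of_int n * b = (\<Sum>b'\<in>B. of_int (if b' = b then n else 0) * b')"
    using assms by (subst sum.remove[of B b]) (auto intro!: sum.neutral)
  then show ?thesis unfolding int_span_def by (auto intro: exI[of _ "\<lambda>b'. if b' = b then n else 0"])
qed

text \<open>The determinant trick: multiplication by \<open>x\<close> acts on the generators through
  an integer matrix, \<open>x\<close> is an eigenvalue of it, and the characteristic polynomial is
  monic with integer coefficients. The generators may be linearly dependent; a nonzero one
  suffices.\<close>

lemma algebraic_int_if_int_span_stable:
  assumes fin: "finite B" and b0: "b0 \<in> B" "b0 \<noteq> 0"
    and stable: "\<And>b. b \<in> B \<Longrightarrow> x * b \<in> int_span B"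
  shows "algebraic_int x"
proof -
  obtain bs where bs: "set bs = B" "distinct bs"
    using finite_distinct_list[OF fin] by blast
  define n where "n = length bs"
  have "\<forall>b\<in>B. \<exists>c. x * b = (\<Sum>b'\<in>B. of_int (c b') * b')"
    using stable by (auto simp: int_span_def)
  then obtain C where C: "\<And>b. b \<in> B \<Longrightarrow> x * b = (\<Sum>b'\<in>B. of_int (C b b') * b')"
    by metis
  \<comment> \<open>Row \<open>i\<close> holds the coordinates of \<open>x * (bs ! i)\<close>, so
    the vector \<open>v\<close> of the generators themselves is the eigenvector.\<close>
  define A :: "int mat" where "A = mat n n (\<lambda>(i, j). C (bs ! i) (bs ! j))"
  define v where "v = vec n (\<lambda>i. bs ! i)"
  have A: "A \<in> carrier_mat n n" by (simp add: A_def)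
  have A': "map_mat (of_int :: int \<Rightarrow> complex) A \<in> carrier_mat n n" using A by simp
  have sum_bs: "(\<Sum>b\<in>B. f b) = (\<Sum>j\<in>{0..<n}. f (bs ! j))" for f :: "complex \<Rightarrow> complex"
    using bs sum_list_distinct_conv_sum_set[of bs f] sum_list_sum_nth[of "map f bs"]
    by (simp add: n_def)
  have "map_mat of_int A *\<^sub>v v = x \<cdot>\<^sub>v v"
  proof (rule eq_vecI)
    fix i assume "i < dim_vec (x \<cdot>\<^sub>v v)"
    then have i: "i < n" by (simp add: v_def)
    then have "bs ! i \<in> B" using bs by (auto simp: n_def)
    then show "(map_mat of_int A *\<^sub>v v) $ i = (x \<cdot>\<^sub>v v) $ i"
      using i A by (simp add: C sum_bs scalar_prod_def v_def A_def)
  qed (use A in \<open>simp_all add: v_def\<close>)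
  moreover have "v \<noteq> 0\<^sub>v n"
  proof
    assume v0: "v = 0\<^sub>v n"
    obtain i where "i < n" "bs ! i = b0" using b0 bs by (auto simp: n_def in_set_conv_nth)
    then show False using arg_cong[OF v0, of "\<lambda>w. w $ i"] b0 by (simp add: v_def)
  qed
  ultimately have "eigenvalue (map_mat of_int A) x"
    unfolding eigenvalue_def eigenvector_def using A by (intro exI[of _ v]) (simp add: v_def)
  then have "poly (char_poly (map_mat of_int A)) x = 0"
    using eigenvalue_root_char_poly[OF A'] by simp
  then have "poly (of_int_poly (char_poly A)) x = 0"
    by (simp add: of_int_hom.char_poly_hom[OF A])
  moreover have "lead_coeff (char_poly A) = 1"
    using degree_monic_char_poly[OF A] by simp
  ultimately show ?thesis unfolding algebraic_int_altdef_ipoly by blast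
qed

text \<open>A ring that is finitely generated as a \<int>-module serves as a certificate of
  integrality for all its elements. Requiring \<open>B \<subseteq> A\<close> keeps products of ring
  elements with generators inside \<open>A\<close>.\<close>

definition finite_order :: "complex set \<Rightarrow> bool" where
  "finite_order A \<longleftrightarrow> is_subring A \<and> (\<exists>B. finite B \<and> B \<subseteq> A \<and> A \<subseteq> int_span B)"

text \<open>Multiplication by \<open>x\<close> maps the generators into \<open>A\<close>, hence into
  their span, so the determinant trick applies. Some generator is nonzero because 1 lies in the
  span.\<close>

lemma finite_order_algebraic_int:
  assumes "finite_order A" "x \<in> A"
  shows "algebraic_int x"
proof -
  obtain B where B: "finite B" "B \<subseteq> A" "A \<subseteq> int_span B" and A: "is_subring A"
    using assms by (auto simp: finite_order_def)
  have "1 \<in> int_span B" using is_subringD(2)[OF A] B by blast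
  then obtain c where "1 = (\<Sum>b\<in>B. of_int (c b) * b)" by (auto simp: int_span_def)
  then have "\<exists>b0\<in>B. b0 \<noteq> 0" by (metis (no_types, lifting) mult_zero_right sum.neutral zero_neq_one)
  then obtain b0 where "b0 \<in> B" "b0 \<noteq> 0" by blast
  then show ?thesis
    using B assms(2) by (intro algebraic_int_if_int_span_stable[of B b0]) (auto intro: is_subringD[OF A])
qed

lemma finite_order_Ints: "finite_order \<int>"
  unfolding finite_order_def
proof
  show "is_subring (\<int> :: complex set)" by (auto simp: is_subring_def)
  show "\<exists>B. finite B \<and> B \<subseteq> \<int> \<and> \<int> \<subseteq> int_span B"
  proof (intro exI[of _ "{1}"] conjI subsetI)
    fix x :: complex assume "x \<in> \<int>"
    then show "x \<in> int_span {1}"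
      using int_span_scale[of "{1}" 1] by (auto elim!: Ints_cases)
  qed auto
qed

text \<open>The witness is \<open>A[x]\<close>. Division by the monic \<open>p\<close> reduces every
  polynomial in \<open>x\<close> to degree below \<open>degree p\<close>, so finitely many powers of
  \<open>x\<close> generate \<open>A[x]\<close> over \<open>A\<close>.\<close>

lemma finite_order_adjoin:
  assumes A: "finite_order A" and p: "p \<in> poly_over A" "lead_coeff p = 1" "poly p x = 0"
  obtains A' where "finite_order A'" "A \<subseteq> A'" "x \<in> A'"
proof
  obtain B where B: "finite B" "B \<subseteq> A" "A \<subseteq> int_span B" and R: "is_subring A"
    using A by (auto simp: finite_order_def)
  note RX = is_subringD[OF is_subring_poly_over[OF R]]
  define A' where "A' = {poly q x |q. q \<in> poly_over A}"
  show sub: "A \<subseteq> A'"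
  proof
    fix a assume "a \<in> A"
    then have "[:a:] \<in> poly_over A" by (rule poly_over_const[OF R])
    then show "a \<in> A'" unfolding A'_def by (auto intro!: exI[of _ "[:a:]"])
  qed
  have X: "[:0, 1:] \<in> poly_over A"
    by (intro poly_over_linear R is_subringD)
  then show x: "x \<in> A'" unfolding A'_def by (auto intro!: exI[of _ "[:0, 1:]"])
  have A'R: "is_subring A'"
    unfolding is_subring_def
  proof (intro conjI ballI)
    fix u v assume "u \<in> A'" "v \<in> A'"
    then obtain q s where qs: "q \<in> poly_over A" "u = poly q x" "s \<in> poly_over A" "v = poly s x"
      by (auto simp: A'_def)
    then have "u + v = poly (q + s) x" "u * v = poly (q * s) x" by simp_all
    then show "u + v \<in> A'" "u * v \<in> A'" unfolding A'_def using qs RX by blast+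
  next
    fix u assume "u \<in> A'"
    then obtain q where "q \<in> poly_over A" "u = poly q x" by (auto simp: A'_def)
    then show "- u \<in> A'" unfolding A'_def using RX(3)[of q] by (auto intro!: exI[of _ "- q"])
  qed (use sub is_subringD[OF R] in auto)
  define n where "n = degree p"
  \<comment> \<open>Generators of \<open>A\<close> times the powers of \<open>x\<close> below
    \<open>n\<close> generate \<open>A[x]\<close> over \<int>.\<close>
  define B' where "B' = (\<lambda>(b, k). b * x ^ k) ` (B \<times> {..<n})"
  have "A' \<subseteq> int_span B'"
  proof
    fix u assume "u \<in> A'"
    then obtain q where q: "q \<in> poly_over A" "u = poly q x" by (auto simp: A'_def)
    obtain s r where r: "r \<in> poly_over A" "q = p * s + r" "\<forall>i\<ge>n. coeff r i = 0"
      using poly_over_monic_division[OF R p(1,2) q(1)] n_def by blast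
    have "u = poly r x"
      using q r p by simp
    then have "u = (\<Sum>k\<le>degree r. coeff r k * x ^ k)"
      by (simp add: poly_altdef)
    also have "\<dots> = (\<Sum>k<n. coeff r k * x ^ k)"
      using r(3) by (intro sum.mono_neutral_cong) (auto simp: not_less coeff_eq_0)
    also have "\<dots> \<in> int_span B'"
    proof (rule int_span_sum)
      fix k assume k: "k \<in> {..<n}"
      obtain c where "coeff r k = (\<Sum>b\<in>B. of_int (c b) * b)"
        using B poly_overD[OF r(1), of k] by (auto simp: int_span_def)
      then have "coeff r k * x ^ k = (\<Sum>b\<in>B. of_int (c b) * (b * x ^ k))"
        by (simp add: sum_distrib_right mult.assoc)
      also have "\<dots> \<in> int_span B'"
        using B k by (intro int_span_sum int_span_scale) (auto simp: B'_def)
      finally show "coeff r k * x ^ k \<in> int_span B'" .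
    qed
    finally show "u \<in> int_span B'" .
  qed
  moreover have "B' \<subseteq> A'"
    using B sub x by (auto simp: B'_def intro!: is_subringD(5)[OF A'R] is_subring_power[OF A'R])
  moreover have "finite B'" using B by (simp add: B'_def)
  ultimately show "finite_order A'"
    using A'R by (auto simp: finite_order_def)
qed

lemma finite_order_containing:
  assumes "finite X" "\<And>x. x \<in> X \<Longrightarrow> algebraic_int x"
  shows "\<exists>A. finite_order A \<and> X \<subseteq> A"
  using assms
proof (induction X rule: finite_induct)
  case empty
  then show ?case using finite_order_Ints by blast
next
  case (insert x X)
  then obtain A where A: "finite_order A" "X \<subseteq> A" by auto
  obtain p where p: "poly (of_int_poly p) x = 0" "lead_coeff p = 1"
    using insert.prems by (auto simp: algebraic_int_altdef_ipoly)
  have "(of_int_poly p :: complex poly) \<in> poly_over A"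
    using A by (intro poly_over_of_int_poly) (auto simp: finite_order_def)
  moreover have "lead_coeff (of_int_poly p :: complex poly) = 1" using p by simp
  ultimately obtain A' where "finite_order A'" "A \<subseteq> A'" "x \<in> A'"
    using finite_order_adjoin[OF A(1)] p(1) by blast
  then show ?case using A by blast
qed

text \<open>Two algebraic integers lie in a common finite order, which contains their sum and
  product.\<close>

lemma is_subring_algebraic_int: "is_subring {x :: complex. algebraic_int x}"
  unfolding is_subring_def
proof (intro conjI ballI)
  fix x y :: complex assume "x \<in> {x. algebraic_int x}" "y \<in> {x. algebraic_int x}"
  then obtain A where A: "finite_order A" "{x, y} \<subseteq> A"
    using finite_order_containing[of "{x, y}"] by auto
  then have "x + y \<in> A" "x * y \<in> A"
    using is_subringD[of A] by (auto simp: finite_order_def)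
  then show "x + y \<in> {x. algebraic_int x}" "x * y \<in> {x. algebraic_int x}"
    using finite_order_algebraic_int A by auto
qed simp_all

text \<open>The finitely many coefficients of \<open>p\<close> lie in one finite order, and
  adjoining the root \<open>x\<close> gives another.\<close>

lemma algebraic_int_integrally_closed:
  fixes x :: complex
  assumes "p \<in> poly_over {x. algebraic_int x}" "lead_coeff p = 1" "poly p x = 0"
  shows "algebraic_int x"
proof -
  have "algebraic_int c" if "c \<in> set (coeffs p)" for c
    using that assms(1) by (auto simp: poly_over_def coeffs_def split: if_splits)
  then obtain A where A: "finite_order A" "set (coeffs p) \<subseteq> A"
    using finite_order_containing[of "set (coeffs p)"] by auto
  have "coeff p i \<in> A" for i
  proof (cases "i \<le> degree p \<and> p \<noteq> 0")
    case True
    then have "coeff p i \<in> set (coeffs p)" by (auto simp: in_set_conv_nth length_coeffs_degree coeffs_nth intro!: exI[of _ i])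
    then show ?thesis using A(2) by blast
  next
    case False
    then show ?thesis using A by (auto simp: finite_order_def coeff_eq_0 intro: is_subringD)
  qed
  then have "p \<in> poly_over A" by (rule poly_overI)
  then obtain A' where "finite_order A'" "x \<in> A'"
    using finite_order_adjoin[OF A(1)] assms by blast
  then show ?thesis by (rule finite_order_algebraic_int)
qed

section \<open>Leading coefficients and products of roots\<close>

text \<open>Multiplying \<open>p(x) = 0\<close> by \<open>a ^ (n - 1)\<close> gives a monic equation
  for \<open>a * x\<close> whose lower coefficients are those of \<open>p\<close> times powers of
  \<open>a\<close>.\<close>

lemma algebraic_int_lead_coeff_mult_root:
  fixes x :: complex
  assumes p: "p \<in> poly_over {x. algebraic_int x}" "poly p x = 0"
  shows "algebraic_int (lead_coeff p * x)"
proof (cases "degree p = 0")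
  case True
  then obtain c where "p = [:c:]" by (rule degree_eq_zeroE)
  then show ?thesis using p by simp
next
  case False
  note O = is_subringD[OF is_subring_algebraic_int, simplified]
  define n a where "n = degree p" and "a = lead_coeff p"
  have n: "n > 0" and a: "a \<noteq> 0" using False by (auto simp: n_def a_def)
  define q where "q = Polynomial.monom 1 n + (\<Sum>i<n. Polynomial.monom (coeff p i * a ^ (n - 1 - i)) i)"
  have cq: "coeff q i = (if i = n then 1 else if i < n then coeff p i * a ^ (n - 1 - i) else 0)" for i
    by (simp add: q_def coeff_sum)
  have "degree q \<le> n" by (intro degree_le) (auto simp: cq)
  moreover have "coeff q n = 1" by (simp add: cq)
  ultimately have dq: "degree q = n" by (metis le_degree le_antisym zero_neq_one)
  \<comment> \<open>The extra factor \<open>a\<close> turns \<open>a ^ (n - 1)\<close> into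
    \<open>a ^ n\<close>, so that the top term and the lower terms have the same factor.\<close>
  have "a * poly q (a * x) = a * (\<Sum>i\<le>n. coeff q i * (a * x) ^ i)"
    by (simp add: poly_altdef dq)
  also have "\<dots> = (\<Sum>i\<le>n. a ^ n * (coeff p i * x ^ i))"
    unfolding sum_distrib_left
  proof (rule sum.cong)
    fix i assume "i \<in> {..n}"
    then consider "i = n" | "i < n" by force
    then show "a * (coeff q i * (a * x) ^ i) = a ^ n * (coeff p i * x ^ i)"
    proof cases
      case 1
      then show ?thesis by (simp add: cq power_mult_distrib a_def n_def)
    next
      case 2
      then have "a ^ n = a * a ^ (n - 1 - i) * a ^ i"
        by (simp flip: power_Suc power_add)
      then show ?thesis using 2 by (simp add: cq power_mult_distrib)
    qed
  qed simp
  also have "\<dots> = a ^ n * poly p x" by (simp add: poly_altdef n_def sum_distrib_left)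
  finally have root: "poly q (a * x) = 0" using a p by simp
  have over: "q \<in> poly_over {x. algebraic_int x}"
  proof (rule poly_overI)
    fix i
    have "algebraic_int a" "algebraic_int (coeff p i)"
      using p(1) by (simp_all add: poly_over_def a_def)
    then have "algebraic_int (coeff p i * a ^ (n - 1 - i))"
      using is_subring_power[OF is_subring_algebraic_int, of a] O(5) by simp
    then show "coeff q i \<in> {x. algebraic_int x}" by (simp add: cq)
  qed
  have "lead_coeff q = 1" using dq \<open>coeff q n = 1\<close> by simp
  from algebraic_int_integrally_closed[OF over this root] show ?thesis
    by (simp only: a_def)
qed

text \<open>The leading coefficient of the product times the root is integral, so the leading term of
  \<open>q\<close> can be split off.\<close>

lemma poly_over_algebraic_int_div_root:
  fixes x :: complex
  assumes "[:- x, 1:] * q \<in> poly_over {x. algebraic_int x}"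
  shows "q \<in> poly_over {x. algebraic_int x}"
  using assms
proof (induction "degree q" arbitrary: q rule: less_induct)
  case less
  note O = is_subring_algebraic_int
  note OX = is_subringD[OF is_subring_poly_over[OF O]]
  show ?case
  proof (cases "q = 0")
    case True
    then show ?thesis using OX by simp
  next
    case False
    define n a where "n = degree q" and "a = lead_coeff q"
    let ?p = "[:- x, 1:] * q"
    have lc: "lead_coeff ?p = a" unfolding lead_coeff_mult a_def by simp
    have a: "algebraic_int a"
      using poly_overD[OF less.prems, of "degree ?p"] lc by simp
    have ax: "algebraic_int (a * x)"
      using algebraic_int_lead_coeff_mult_root[OF less.prems, of x] unfolding lc by simp
    define q' where "q' = q - Polynomial.monom a n"
    have *: "Polynomial.monom a n = Polynomial.smult a (Polynomial.monom 1 n)"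
      "[:- (a * x), a:] = Polynomial.smult a [:- x, 1:]" by (simp_all add: smult_monom)
    have "[:- x, 1:] * q' = ?p - Polynomial.monom 1 n * [:- (a * x), a:]"
      unfolding q'_def right_diff_distrib * mult_smult_right by (simp only: mult.commute)
    also have "\<dots> \<in> poly_over {x. algebraic_int x}"
    proof (rule OX(6)[OF less.prems OX(5)])
      show "Polynomial.monom 1 n \<in> poly_over {x :: complex. algebraic_int x}"
        by (auto simp: poly_over_def)
      show "[:- (a * x), a:] \<in> poly_over {x. algebraic_int x}"
        using a ax by (intro poly_over_pCons O) (auto intro: OX)
    qed
    finally have 1: "[:- x, 1:] * q' \<in> poly_over {x. algebraic_int x}" .
    have "q' \<in> poly_over {x. algebraic_int x}"
    proof (cases "q' = 0")
      case True
      then show ?thesis using OX by simp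
    next
      case False
      have "coeff q' i = 0" if "i \<ge> n" for i
        using that by (cases "i = n") (auto simp: q'_def n_def a_def coeff_eq_0)
      then have "degree q' < n" using False by (metis leading_coeff_0_iff not_le)
      then show ?thesis using less.hyps 1 by (simp add: n_def)
    qed
    moreover have "Polynomial.monom a n \<in> poly_over {x. algebraic_int x}"
      using a by (auto simp: poly_over_def)
    moreover have "q = q' + Polynomial.monom a n" by (simp add: q'_def)
    ultimately show ?thesis using OX(4)[of q' "Polynomial.monom a n"] by simp
  qed
qed

text \<open>Dividing out the roots indexed outside \<open>T\<close> one at a time preserves
  integrality, and the constant coefficient of what remains is the wanted product up to sign.
  Indexing by \<open>z\<close> allows repeated values \<open>w z\<close>.\<close>

lemma algebraic_int_prod_subset_roots:
  fixes w :: "'a \<Rightarrow> complex"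
  assumes "finite R" "T \<subseteq> R"
    and "Polynomial.smult a (\<Prod>z\<in>R. [:- w z, 1:]) \<in> poly_over {x. algebraic_int x}"
  shows "algebraic_int (a * (\<Prod>z\<in>T. w z))"
proof -
  have "Polynomial.smult a (\<Prod>z\<in>T. [:- w z, 1:]) \<in> poly_over {x. algebraic_int x}"
    if "finite S" "Polynomial.smult a (\<Prod>z\<in>T \<union> S. [:- w z, 1:]) \<in> poly_over {x. algebraic_int x}" "T \<inter> S = {}"
    for S
    using that
  proof (induction S rule: finite_induct)
    case (insert s S)
    have "finite T" using assms finite_subset by blast
    then have "(\<Prod>z\<in>T \<union> insert s S. [:- w z, 1:]) = [:- w s, 1:] * (\<Prod>z\<in>T \<union> S. [:- w z, 1:])"
      using insert.hyps insert.prems(2) by simp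
    then have "[:- w s, 1:] * Polynomial.smult a (\<Prod>z\<in>T \<union> S. [:- w z, 1:]) \<in> poly_over {x. algebraic_int x}"
      using insert.prems(1) by (metis mult_smult_right)
    then show ?case
      using insert.prems(2) by (blast intro: insert.IH[OF poly_over_algebraic_int_div_root])
  qed simp
  from this[of "R - T"] have "Polynomial.smult a (\<Prod>z\<in>T. [:- w z, 1:]) \<in> poly_over {x. algebraic_int x}"
    using assms by (simp add: Un_absorb1 finite_subset)
  then have "algebraic_int (a * coeff (\<Prod>z\<in>T. [:- w z, 1:]) 0)"
    by (auto simp: poly_over_def dest: spec[of _ 0])
  also have "coeff (\<Prod>z\<in>T. [:- w z, 1:]) 0 = (-1) ^ card T * (\<Prod>z\<in>T. w z)"
    by (simp flip: poly_0_coeff_0 add: poly_prod prod_uminus)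
  finally show ?thesis by (cases "even (card T)") auto
qed

subsection \<open>Minimal polynomials over a subfield\<close>

lemma is_subfield_imp_subring: "is_subfield F \<Longrightarrow> is_subring F"
  by (auto simp: is_subfield_def is_subring_def)

lemma is_subfield_inverse: "is_subfield F \<Longrightarrow> x \<in> F \<Longrightarrow> inverse x \<in> F"
  by (auto simp: is_subfield_def)

lemma is_subfield_Rats: "is_subfield \<rat>"
  by (auto simp: is_subfield_def)

lemma Rats_subset_subfield:
  assumes "is_subfield F"
  shows "\<rat> \<subseteq> F"
proof
  fix x :: complex assume "x \<in> \<rat>"
  then obtain a b where "x = of_int a / of_int b" by (auto elim: Rats_cases')
  then show "x \<in> F"
    using is_subring_of_int[OF is_subfield_imp_subring[OF assms]] is_subfield_inverse[OF assms]
      is_subringD(5)[OF is_subfield_imp_subring[OF assms]] by (simp add: divide_inverse)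
qed

text \<open>Minimality is expressed by divisibility. Recording that the cofactor \<open>s\<close> is
  again over \<open>F\<close> allows repeated factorisation. The base field is a parameter because
  both \<rat> and fields \<open>Q_adjoin {y}\<close> occur.\<close>

definition is_min_poly :: "complex set \<Rightarrow> complex poly \<Rightarrow> complex \<Rightarrow> bool" where
  "is_min_poly F q x \<longleftrightarrow> q \<in> poly_over F \<and> lead_coeff q = 1 \<and> poly q x = 0 \<and>
     (\<forall>p\<in>poly_over F. poly p x = 0 \<longrightarrow> (\<exists>s\<in>poly_over F. p = q * s))"

lemma is_min_polyD:
  assumes "is_min_poly F q x"
  shows "q \<in> poly_over F" "lead_coeff q = 1" "poly q x = 0"
    "p \<in> poly_over F \<Longrightarrow> poly p x = 0 \<Longrightarrow> q dvd p"
    "p \<in> poly_over F \<Longrightarrow> poly p x = 0 \<Longrightarrow> \<exists>s\<in>poly_over F. p = q * s"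
  using assms by (auto simp: is_min_poly_def)

lemma is_min_poly_nz: "is_min_poly F q x \<Longrightarrow> q \<noteq> 0"
  using is_min_polyD(2) by fastforce

lemma is_min_poly_degree_pos:
  assumes "is_min_poly F q x"
  shows "degree q > 0"
proof (rule ccontr)
  assume "\<not> degree q > 0"
  then obtain c where "q = [:c:]" using degree_eq_zeroE[of q] by blast
  then show False using is_min_polyD[OF assms] by simp
qed

lemma is_min_poly_degree_le:
  assumes "is_min_poly F q x" "p \<in> poly_over F" "poly p x = 0" "p \<noteq> 0"
  shows "degree q \<le> degree p"
  using is_min_polyD(4)[OF assms(1-3)] assms(4) by (rule dvd_imp_degree_le)

text \<open>Take a nonzero polynomial of least degree vanishing at \<open>x\<close> and make it
  monic; a nonzero remainder modulo it would vanish at \<open>x\<close> in smaller degree.\<close>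

lemma ex_is_min_poly:
  assumes F: "is_subfield F" and h: "h \<in> poly_over F" "h \<noteq> 0" "poly h x = 0"
  obtains q where "is_min_poly F q x"
proof -
  note R = is_subfield_imp_subring[OF F]
  define P where "P = (\<lambda>p. p \<in> poly_over F \<and> p \<noteq> 0 \<and> poly p x = 0)"
  obtain p where p: "P p" and min: "\<And>p'. P p' \<Longrightarrow> degree p \<le> degree p'"
    using h ex_has_least_nat[of P h degree] by (auto simp: P_def)
  define q where "q = Polynomial.smult (inverse (lead_coeff p)) p"
  have lc: "lead_coeff p \<noteq> 0" using p by (simp add: P_def)
  have q: "q \<in> poly_over F" "lead_coeff q = 1" "poly q x = 0" and dq: "degree q = degree p"
    using p lc is_subfield_inverse[OF F] by (auto simp: q_def P_def intro!: poly_over_smult R poly_overD)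
  have "\<exists>s\<in>poly_over F. g = q * s" if g: "g \<in> poly_over F" "poly g x = 0" for g
  proof -
    obtain s r where sr: "s \<in> poly_over F" "r \<in> poly_over F" "g = q * s + r" "\<forall>i\<ge>degree q. coeff r i = 0"
      using poly_over_monic_division[OF R q(1,2) g(1)] by blast
    have "r = 0"
    proof (rule ccontr)
      assume "r \<noteq> 0"
      moreover from this have "degree r < degree q"
        using sr(4) by (metis leading_coeff_0_iff not_le)
      moreover have "poly r x = 0" using sr(3) g q by simp
      ultimately show False using min[of r] sr(2) dq by (simp add: P_def)
    qed
    then show ?thesis using sr by auto
  qed
  then have "is_min_poly F q x" using q by (simp add: is_min_poly_def)
  then show ?thesis by (rule that)
qed

text \<open>Write \<open>q = p * s\<close> with \<open>p\<close> minimal for \<open>z\<close>. The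
  cofactor \<open>s\<close> has too small a degree to vanish at \<open>x\<close>, so
  \<open>p\<close> does; hence \<open>p\<close> has the degree of \<open>q\<close>, and
  \<open>s = 1\<close> by comparing leading coefficients.\<close>

lemma is_min_poly_conjugate:
  assumes F: "is_subfield F" and q: "is_min_poly F q x" and z: "poly q z = 0"
  shows "is_min_poly F q z"
proof -
  obtain p where p: "is_min_poly F p z"
    using ex_is_min_poly[OF F is_min_polyD(1)[OF q] is_min_poly_nz[OF q] z] by blast
  obtain s where s: "s \<in> poly_over F" "q = p * s"
    using is_min_polyD(5)[OF p is_min_polyD(1)[OF q] z] by blast
  have nz: "p \<noteq> 0" "s \<noteq> 0" using s is_min_poly_nz[OF q] by auto
  have "poly p x * poly s x = 0" using is_min_polyD(3)[OF q] s by simp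
  moreover have "poly s x \<noteq> 0"
  proof
    assume "poly s x = 0"
    then have "degree q \<le> degree s" using is_min_poly_degree_le[OF q s(1)] nz by blast
    then show False using s nz is_min_poly_degree_pos[OF p] by (simp add: degree_mult_eq)
  qed
  ultimately have "poly p x = 0" by simp
  then have "degree q \<le> degree p" using is_min_poly_degree_le[OF q is_min_polyD(1)[OF p]] nz by blast
  then have "degree s = 0" using s nz by (simp add: degree_mult_eq)
  then obtain c where c: "s = [:c:]" by (rule degree_eq_zeroE)
  have "lead_coeff q = lead_coeff p * lead_coeff s" using s by (simp add: lead_coeff_mult)
  then have "c = 1" using is_min_polyD(2)[OF q] is_min_polyD(2)[OF p] c by simp
  then show ?thesis using p s c by simp
qed

text \<open>In characteristic 0 the derivative is nonzero and of smaller degree, so minimality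
  excludes a root at \<open>x\<close>.\<close>

lemma is_min_poly_pderiv:
  assumes F: "is_subfield F" and q: "is_min_poly F q x"
  shows "poly (pderiv q) x \<noteq> 0"
proof
  assume 0: "poly (pderiv q) x = 0"
  have "pderiv q \<noteq> 0" using is_min_poly_degree_pos[OF q] by (simp add: pderiv_eq_0_iff)
  then have "degree q \<le> degree (pderiv q)"
    using is_min_poly_degree_le[OF q poly_over_pderiv[OF is_subfield_imp_subring[OF F] is_min_polyD(1)[OF q]] 0]
    by blast
  then show False using is_min_poly_degree_pos[OF q] by (simp add: degree_pderiv)
qed

text \<open>\<open>q\<close> is the minimal polynomial of each of its roots, so its derivative
  vanishes at none of them and all roots are simple.\<close>

lemma is_min_poly_roots:
  assumes F: "is_subfield F" and q: "is_min_poly F q x"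
  shows "card {z. poly q z = 0} = degree q" "q = (\<Prod>z\<in>{z. poly q z = 0}. [:- z, 1:])"
proof -
  let ?R = "{z. poly q z = 0}"
  note q0 = is_min_poly_nz[OF q]
  have "rsquarefree q"
    unfolding rsquarefree_roots using is_min_poly_pderiv[OF F is_min_poly_conjugate[OF F q]] by blast
  then show card: "card ?R = degree q"
    using rsquarefree_card_degree[OF q0] by simp
  have fin: "finite ?R" using q0 by (rule poly_roots_finite)
  define p where "p = (\<Prod>z\<in>?R. [:- z, 1:])"
  have dp: "degree p = degree q"
    unfolding p_def card[symmetric] by (subst degree_prod_eq_sum_degree) auto
  have lp: "lead_coeff p = 1"
    unfolding p_def lead_coeff_prod by simp
  \<comment> \<open>Both are monic of the same degree, so a nonzero difference would have fewer than
    \<open>degree q\<close> roots, yet it vanishes on all of \<open>?R\<close>.\<close>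
  have "q - p = 0"
  proof (rule ccontr)
    assume nz: "q - p \<noteq> 0"
    have "coeff (q - p) i = 0" if "i \<ge> degree q" for i
      using that lp is_min_polyD(2)[OF q] dp by (cases "i = degree q") (auto simp: coeff_eq_0)
    then have "degree (q - p) < degree q"
      using nz by (metis leading_coeff_0_iff not_le)
    moreover have "?R \<subseteq> {z. poly (q - p) z = 0}"
      using fin by (auto simp: p_def poly_prod)
    then have "card ?R \<le> card {z. poly (q - p) z = 0}"
      using poly_roots_finite[OF nz] by (rule card_mono[rotated])
    then have "card ?R \<le> degree (q - p)"
      using card_poly_roots_bound[OF nz] by simp
    ultimately show False using card by simp
  qed
  then show "q = (\<Prod>z\<in>?R. [:- z, 1:])" by (simp add: p_def)
qed

text \<open>The minimal polynomial over \<open>F\<close> divides both polynomials, so it has only one root; being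
  separable, it is linear.\<close>

lemma unique_common_root_in_subfield:
  assumes F: "is_subfield F" and g: "g \<in> poly_over F" "g \<noteq> 0" and h: "h \<in> poly_over F"
    and x: "poly g x = 0" "poly h x = 0"
    and unique: "\<And>z. poly g z = 0 \<Longrightarrow> poly h z = 0 \<Longrightarrow> z = x"
  shows "x \<in> F"
proof -
  obtain q where q: "is_min_poly F q x" using ex_is_min_poly[OF F g x(1)] by blast
  have "q dvd g" "q dvd h" using is_min_polyD(4)[OF q] g h x by auto
  then have "{z. poly q z = 0} = {x}"
    using unique is_min_polyD(3)[OF q] by (auto elim!: dvdE)
  then have "q = [:- x, 1:]" using is_min_poly_roots(2)[OF F q] by simp
  then have "- x \<in> F" using poly_overD[OF is_min_polyD(1)[OF q], of 0] by simp
  then show ?thesis using is_subringD(3)[OF is_subfield_imp_subring[OF F], of "- x"] by simp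
qed

text \<open>Any root of \<open>p\<close> is a conjugate of \<open>x\<close>, so \<open>q\<close> is
  its minimal polynomial and divides \<open>p\<close>; the monic cofactor satisfies the same
  hypotheses in smaller degree.\<close>

lemma power_of_min_poly:
  assumes F: "is_subfield F" and q: "is_min_poly F q x"
    and p: "p \<in> poly_over F" "lead_coeff p = 1" "\<And>z. poly p z = 0 \<Longrightarrow> poly q z = 0"
  shows "\<exists>k. p = q ^ k"
  using p
proof (induction "degree p" arbitrary: p rule: less_induct)
  case less
  show ?case
  proof (cases "degree p = 0")
    case True
    then obtain c where "p = [:c:]" by (rule degree_eq_zeroE)
    with less.prems(2) have "p = q ^ 0" by (simp add: pCons_one)
    then show ?thesis ..
  next
    case False
    then obtain z where z: "poly p z = 0"
      using fundamental_theorem_of_algebra[of p] by (auto simp: constant_degree)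
    note qz = is_min_poly_conjugate[OF F q less.prems(3)[OF z]]
    obtain s where s: "s \<in> poly_over F" "p = q * s"
      using is_min_polyD(5)[OF qz less.prems(1) z] by blast
    have nz: "q \<noteq> 0" "s \<noteq> 0" using s less.prems(2) by auto
    have "degree s < degree p"
      using s nz is_min_poly_degree_pos[OF q] by (simp add: degree_mult_eq)
    moreover have "lead_coeff s = 1"
      using less.prems(2) is_min_polyD(2)[OF q] s by (simp add: lead_coeff_mult)
    ultimately obtain k where "s = q ^ k"
      using less.hyps[of s] s less.prems(3) by auto
    then show ?thesis using s by (intro exI[of _ "Suc k"]) simp
  qed
qed

subsection \<open>Newton's identities and rationality of norms\<close>

text \<open>The logarithmic derivative of the product is minus the generating series of the power
  sums; comparing coefficients of \<open>X ^ k\<close> gives the identity. Factors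
  \<open>1 - w X\<close> are used because they are invertible as power series.\<close>

lemma newton_identity:
  fixes w :: "'a \<Rightarrow> complex"
  assumes "finite A"
  shows "of_nat (Suc k) * coeff (\<Prod>a\<in>A. [:1, - w a:]) (Suc k) =
    - (\<Sum>i\<le>k. coeff (\<Prod>a\<in>A. [:1, - w a:]) i * (\<Sum>a\<in>A. w a ^ Suc (k - i)))"
proof -
  define S where "S = (\<lambda>A. Abs_fps (\<lambda>k. \<Sum>a\<in>A. w a ^ Suc k))"
  \<comment> \<open>The geometric series. Read backwards, it makes \<open>fps_const (w a)\<close>,
    the negated derivative of the factor, a multiple of that factor.\<close>
  have geo: "fps_of_poly [:1, - w a:] * Abs_fps (\<lambda>k. w a ^ Suc k) = fps_const (w a)" for a
  proof (rule fps_ext)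
    fix k
    show "fps_nth (fps_of_poly [:1, - w a:] * Abs_fps (\<lambda>k. w a ^ Suc k)) k = fps_nth (fps_const (w a)) k"
      by (cases k) (simp_all add: fps_of_poly_pCons ring_distribs mult.assoc fps_mult_left_const_nth)
  qed
  have "fps_deriv (fps_of_poly (\<Prod>a\<in>A. [:1, - w a:])) = - (fps_of_poly (\<Prod>a\<in>A. [:1, - w a:]) * S A)"
    using assms
  proof (induction A rule: finite_induct)
    case empty
    then show ?case by (simp add: S_def fps_zero_def[symmetric])
  next
    case (insert a A)
    let ?L = "fps_of_poly [:1, - w a:]" and ?P = "fps_of_poly (\<Prod>a\<in>A. [:1, - w a:])"
    have S: "S (insert a A) = Abs_fps (\<lambda>k. w a ^ Suc k) + S A"
      using insert.hyps by (auto simp: S_def fps_eq_iff)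
    have L: "fps_deriv ?L = - fps_const (w a)"
      by (auto simp: fps_eq_iff coeff_pCons split: nat.split)
    have "fps_deriv (?L * ?P) = - (?L * ?P * S (insert a A))"
      unfolding fps_deriv_mult insert.IH L S geo[of a, symmetric] by (simp only: algebra_simps mult_minus_right mult_minus_left minus_add_distrib)
    then show ?case by (simp only: prod.insert[OF insert.hyps] fps_of_poly_mult)
  qed
  from arg_cong[OF this, of "\<lambda>f. fps_nth f k"] show ?thesis
    by (simp add: fps_mult_nth S_def atLeast0AtMost)
qed

text \<open>In Newton's identity the \<open>k\<close>-th power sum has coefficient
  \<open>?c 0 = 1\<close>, and all other power sums have smaller exponent.\<close>

lemma power_sums_rational:
  fixes w :: "'a \<Rightarrow> complex"
  assumes "finite A" "(\<Prod>a\<in>A. [:1, - w a:]) \<in> poly_over \<rat>"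
  shows "(\<Sum>a\<in>A. w a ^ k) \<in> \<rat>"
proof (induction k rule: less_induct)
  case (less k)
  show ?case
  proof (cases k)
    case (Suc m)
    let ?c = "coeff (\<Prod>a\<in>A. [:1, - w a:])"
    have c: "?c i \<in> \<rat>" for i using assms(2) by (rule poly_overD)
    have c0: "?c 0 = 1" by (simp flip: poly_0_coeff_0 add: poly_prod)
    have split: "(\<Sum>i\<le>m. ?c i * (\<Sum>a\<in>A. w a ^ Suc (m - i))) =
        (\<Sum>a\<in>A. w a ^ k) + (\<Sum>i\<in>{1..m}. ?c i * (\<Sum>a\<in>A. w a ^ Suc (m - i)))"
      using c0 Suc by (simp add: sum.atMost_shift sum.atLeast1_atMost_eq)
    have "(\<Sum>a\<in>A. w a ^ k) = - (of_nat (Suc m) * ?c (Suc m)) -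
        (\<Sum>i\<in>{1..m}. ?c i * (\<Sum>a\<in>A. w a ^ Suc (m - i)))"
      using newton_identity[OF assms(1), of m w] unfolding split by (simp only: minus_add_distrib) simp
    also have "\<dots> \<in> \<rat>"
    proof -
      have "?c i * (\<Sum>a\<in>A. w a ^ Suc (m - i)) \<in> \<rat>" if "i \<in> {1..m}" for i
        using that Suc by (intro Rats_mult c less.IH) auto
      then have "(\<Sum>i\<in>{1..m}. ?c i * (\<Sum>a\<in>A. w a ^ Suc (m - i))) \<in> \<rat>"
        by (rule Rats_sum)
      then show ?thesis using c by (intro Rats_diff Rats_minus_iff[THEN iffD2] Rats_mult Rats_of_nat)
    qed
    finally show ?thesis .
  qed simp
qed

text \<open>Newton's identity solved in the other direction, for the next coefficient; the division
  by \<open>Suc m\<close> is harmless over \<rat>.\<close>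

lemma prod_rational_if_power_sums_rational:
  fixes w :: "'a \<Rightarrow> complex"
  assumes "finite A" "\<And>k. (\<Sum>a\<in>A. w a ^ k) \<in> \<rat>"
  shows "(\<Prod>a\<in>A. [:1, - w a:]) \<in> poly_over \<rat>"
proof (rule poly_overI)
  let ?c = "coeff (\<Prod>a\<in>A. [:1, - w a:])"
  fix k
  show "?c k \<in> \<rat>"
  proof (induction k rule: less_induct)
    case (less k)
    show ?case
    proof (cases k)
      case 0
      then show ?thesis by (simp flip: poly_0_coeff_0 add: poly_prod)
    next
      case (Suc m)
      have "?c k = - (\<Sum>i\<le>m. ?c i * (\<Sum>a\<in>A. w a ^ Suc (m - i))) / of_nat (Suc m)"
        unfolding newton_identity[OF assms(1), of m w, symmetric] Suc
        by (rule nonzero_mult_div_cancel_left[symmetric]) (simp del: of_nat_Suc)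
      also have "\<dots> \<in> \<rat>"
      proof -
        have "?c i * (\<Sum>a\<in>A. w a ^ Suc (m - i)) \<in> \<rat>" if "i \<in> {..m}" for i
          using that Suc by (intro Rats_mult less.IH assms(2)) auto
        then have "(\<Sum>i\<le>m. ?c i * (\<Sum>a\<in>A. w a ^ Suc (m - i))) \<in> \<rat>"
          by (rule Rats_sum)
        then show ?thesis by (intro Rats_divide Rats_minus_iff[THEN iffD2] Rats_of_nat)
      qed
      finally show ?thesis .
    qed
  qed
qed

text \<open>Passing to the reciprocal polynomial only reverses the coefficients. Values
  \<open>w a = 0\<close> lower the degree of the reflection, so indices are counted from the degree
  of the unreflected product.\<close>

lemma prod_linear_poly_over_iff_reflect:
  fixes w :: "'a \<Rightarrow> complex"
  assumes "finite A"
  shows "(\<Prod>a\<in>A. [:- w a, 1:]) \<in> poly_over \<rat> \<longleftrightarrow> (\<Prod>a\<in>A. [:1, - w a:]) \<in> poly_over \<rat>"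
proof -
  let ?p = "\<Prod>a\<in>A. [:- w a, 1:]"
  have "reflect_poly [:- w a, 1:] = [:1, - w a:]" for a
    by (simp add: reflect_poly_def coeffs_def)
  then have r: "(\<Prod>a\<in>A. [:1, - w a:]) = reflect_poly ?p"
    by (simp add: reflect_poly_prod)
  show ?thesis
  proof
    assume "?p \<in> poly_over \<rat>"
    then show "(\<Prod>a\<in>A. [:1, - w a:]) \<in> poly_over \<rat>"
      unfolding r by (auto simp: poly_over_def coeff_reflect_poly)
  next
    assume *: "(\<Prod>a\<in>A. [:1, - w a:]) \<in> poly_over \<rat>"
    show "?p \<in> poly_over \<rat>"
    proof (rule poly_overI)
      fix i
      show "coeff ?p i \<in> \<rat>"
      proof (cases "i \<le> degree ?p")
        case True
        then show ?thesis
          using poly_overD[OF *[unfolded r], of "degree ?p - i"] True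
          by (simp only: coeff_reflect_poly diff_diff_cancel) (simp split: if_splits)
      qed (simp add: coeff_eq_0)
    qed
  qed
qed

text \<open>Each power sum of the values \<open>g(z)\<close> is a rational combination of power sums
  of the \<open>z\<close>, so Newton's identities, used in both directions, replace the theorem on
  symmetric polynomials.\<close>

lemma prod_poly_roots_rational:
  fixes R :: "complex set"
  assumes "finite R" "(\<Prod>z\<in>R. [:- z, 1:]) \<in> poly_over \<rat>" and g: "g \<in> poly_over \<rat>"
  shows "(\<Prod>z\<in>R. [:- poly g z, 1:]) \<in> poly_over \<rat>"
proof -
  have s: "(\<Sum>z\<in>R. z ^ k) \<in> \<rat>" for k
    using assms(2) prod_linear_poly_over_iff_reflect[OF assms(1), of "\<lambda>z. z"]
    by (intro power_sums_rational assms(1)) auto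
  have "(\<Sum>z\<in>R. poly g z ^ k) \<in> \<rat>" for k
  proof -
    have "g ^ k \<in> poly_over \<rat>"
      using g by (intro is_subring_power is_subring_poly_over is_subfield_imp_subring is_subfield_Rats)
    then have "(\<Sum>i\<le>degree (g ^ k). coeff (g ^ k) i * (\<Sum>z\<in>R. z ^ i)) \<in> \<rat>"
      by (intro Rats_sum Rats_mult s poly_overD)
    also have "(\<Sum>i\<le>degree (g ^ k). coeff (g ^ k) i * (\<Sum>z\<in>R. z ^ i)) = (\<Sum>z\<in>R. poly (g ^ k) z)"
      unfolding poly_altdef sum_distrib_left by (rule sum.swap)
    finally show ?thesis by simp
  qed
  then show ?thesis
    using prod_rational_if_power_sums_rational[OF assms(1)] prod_linear_poly_over_iff_reflect[OF assms(1)]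
    by blast
qed

subsection \<open>Number fields and primitive elements\<close>

lemma subset_Q_adjoin: "S \<subseteq> Q_adjoin S"
  by (auto simp: Q_adjoin_def)

lemma Q_adjoin_least: "is_subfield F \<Longrightarrow> S \<subseteq> F \<Longrightarrow> Q_adjoin S \<subseteq> F"
  by (auto simp: Q_adjoin_def)

lemma Q_adjoin_subset_iff: "Q_adjoin S \<subseteq> Q_adjoin T \<longleftrightarrow> S \<subseteq> Q_adjoin T"
  using Q_adjoin_least[OF is_subfield_Q_adjoin] subset_Q_adjoin by blast

lemma is_subring_Rats: "is_subring (\<rat> :: complex set)"
  by (rule is_subfield_imp_subring[OF is_subfield_Rats])

lemma is_subring_Q_adjoin: "is_subring (Q_adjoin S)"
  by (rule is_subfield_imp_subring[OF is_subfield_Q_adjoin])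

lemma algebraic_if_root_over_Rats:
  assumes "p \<in> poly_over \<rat>" "p \<noteq> 0" "poly p x = 0"
  shows "algebraic x"
  using assms by (auto simp: algebraic_altdef poly_over_def)

lemma ex_is_min_poly_Rats:
  assumes "algebraic x"
  obtains q where "is_min_poly \<rat> q x"
proof -
  obtain p where "(\<forall>i. coeff p i \<in> \<rat>) \<and> p \<noteq> 0 \<and> poly p x = 0"
    using assms by (auto simp: algebraic_altdef)
  then show ?thesis
    using ex_is_min_poly[OF is_subfield_Rats, of p x] that by (auto simp: poly_over_def)
qed

section \<open>Rational and integral minimal polynomials\<close>

lemma poly_over_Rats_imp_rat_poly:
  fixes p :: "complex poly"
  assumes "p \<in> poly_over \<rat>"
  obtains p' where "p = map_poly of_rat p'"
proof
  define rt where "rt = (\<lambda>z::complex. if z \<in> \<rat> then (SOME r. of_rat r = z) else 0)"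
  have rt: "of_rat (rt z) = z" if "z \<in> \<rat>" for z
  proof -
    have "\<exists>r. of_rat r = z" using that by (auto elim: Rats_cases)
    then show ?thesis using that someI_ex[of "\<lambda>r. of_rat r = z"] by (simp add: rt_def)
  qed
  have "rt 0 = 0" using rt[of 0] by simp
  then show "p = map_poly of_rat (map_poly rt p)"
    using assms by (intro poly_eqI) (simp add: coeff_map_poly rt poly_over_def)
qed

text \<open>By Gauss's lemma the primitive irreducible integer polynomial stays irreducible over
  \<rat>. It is a multiple of \<open>q\<close>, which has positive degree, so the cofactor is
  constant.\<close>

lemma min_int_poly_eq_smult:
  assumes x: "algebraic x" and q: "is_min_poly \<rat> q x"
  shows "of_int_poly (min_int_poly x) = Polynomial.smult (of_int (lead_coeff (min_int_poly x))) q"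
proof -
  define P where "P = min_int_poly x"
  have P: "irreducible P" "poly (of_int_poly P) x = 0" "content P = 1"
    using is_min_int_poly_min_int_poly[OF x] by (auto simp: P_def is_min_int_poly_def)
  then have "irreducible\<^sub>d P"
    using irreducible_primitive_connect[of P] by simp
  then have irr: "irreducible\<^sub>d (of_int_poly P :: rat poly)" by (rule irreducible\<^sub>d_int_rat)
  interpret h: map_poly_inj_comm_ring_hom "of_rat :: rat \<Rightarrow> complex"
    by unfold_locales (simp_all add: of_rat_add of_rat_mult)
  have comp: "map_poly of_rat (of_int_poly P :: rat poly) = (of_int_poly P :: complex poly)"
    by (simp add: map_poly_map_poly o_def)
  obtain s where s: "s \<in> poly_over \<rat>" "of_int_poly P = q * s"
    using is_min_polyD(5)[OF q _ P(2)] poly_over_of_int_poly[OF is_subring_Rats] by blast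
  obtain q' where q': "q = map_poly of_rat q'"
    using poly_over_Rats_imp_rat_poly[OF is_min_polyD(1)[OF q]] by blast
  obtain s' where s': "s = map_poly of_rat s'"
    using poly_over_Rats_imp_rat_poly[OF s(1)] by blast
  \<comment> \<open>The factorisation holds over the complex numbers; injectivity of the coefficient
    embedding pulls it back to \<open>rat poly\<close>, where irreducibility is known.\<close>
  have "map_poly of_rat (of_int_poly P :: rat poly) = (map_poly of_rat (q' * s') :: complex poly)"
    unfolding comp h.hom_mult using s(2) q' s' by simp
  then have eq: "of_int_poly P = q' * s'" by (rule h.injectivity)
  have "of_int_poly P \<noteq> (0 :: rat poly)" using P(1) by auto
  then have nz: "q' \<noteq> 0" "s' \<noteq> 0" using eq by auto
  have dq: "degree q' > 0" using is_min_poly_degree_pos[OF q] q' by simp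
  have "degree s' = 0"
  proof (rule ccontr)
    assume "degree s' \<noteq> 0"
    moreover have "degree (of_int_poly P :: rat poly) = degree q' + degree s'"
      unfolding eq using nz by (rule degree_mult_eq)
    ultimately show False
      using irreducible\<^sub>dD(2)[OF irr, of q' s'] eq dq by simp
  qed
  then have "degree s = 0" using s' by simp
  then obtain c where c: "s = [:c:]" by (rule degree_eq_zeroE)
  have "lead_coeff (of_int_poly P :: complex poly) = c"
    unfolding s(2) lead_coeff_mult c using is_min_polyD(2)[OF q] by simp
  then have "c = of_int (lead_coeff P)" by simp
  then show ?thesis using s(2) c by (simp add: P_def)
qed

lemma alg_degree_eq_degree:
  assumes "algebraic x" "is_min_poly \<rat> q x"
  shows "alg_degree x = degree q"
proof -
  have "lead_coeff (min_int_poly x) > 0"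
    using is_min_int_poly_min_int_poly[OF assms(1)] by (simp add: is_min_int_poly_def)
  then have "degree (of_int_poly (min_int_poly x) :: complex poly) = degree q"
    unfolding min_int_poly_eq_smult[OF assms] by auto
  then show ?thesis by (simp add: alg_degree_def)
qed

section \<open>The field \<rat>(x) and its degree\<close>

text \<open>Writing the minimal polynomial as \<open>c + X h\<close> gives
  \<open>y * h(y) = - c\<close>, and \<open>c = 0\<close> would make the nonzero \<open>h\<close> of
  smaller degree vanish at \<open>y\<close>.\<close>

lemma inverse_eq_poly:
  fixes y :: complex
  assumes "algebraic y" "y \<noteq> 0"
  shows "\<exists>h\<in>poly_over \<rat>. inverse y = poly h y"
proof -
  obtain q where q: "is_min_poly \<rat> q y" using ex_is_min_poly_Rats[OF assms(1)] by blast
  obtain c h where ch: "q = pCons c h" by (rule pCons_cases)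
  have c: "c \<in> \<rat>" and h: "h \<in> poly_over \<rat>"
    using poly_overD[OF is_min_polyD(1)[OF q], of 0] poly_overD[OF is_min_polyD(1)[OF q], of "Suc _"]
    by (auto simp: ch intro: poly_overI)
  have root: "c + y * poly h y = 0" using is_min_polyD(3)[OF q] by (simp add: ch)
  have "c \<noteq> 0"
  proof
    assume "c = 0"
    then have "poly h y = 0" "h \<noteq> 0" using root assms(2) is_min_poly_nz[OF q] ch by auto
    then have "degree q \<le> degree h" using is_min_poly_degree_le[OF q h] by blast
    then show False using ch \<open>h \<noteq> 0\<close> by simp
  qed
  then have "inverse y = poly (Polynomial.smult (- inverse c) h) y"
    using root assms(2) by (simp add: field_simps eq_neg_iff_add_eq_0)
  moreover have "Polynomial.smult (- inverse c) h \<in> poly_over \<rat>"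
    using c h by (intro poly_over_smult is_subring_Rats) auto
  ultimately show ?thesis by blast
qed

text \<open>The product is the norm of \<open>X - g(x)\<close> from \<rat>(x), that is, the
  characteristic polynomial of \<open>g(x)\<close> in this field.\<close>

lemma norm_poly_over_Rats:
  assumes f: "is_min_poly \<rat> f x" and g: "g \<in> poly_over \<rat>"
  shows "(\<Prod>z\<in>{z. poly f z = 0}. [:- poly g z, 1:]) \<in> poly_over \<rat>"
  using is_min_polyD(1)[OF f] is_min_poly_nz[OF f] g
    is_min_poly_roots(2)[OF is_subfield_Rats f, symmetric]
  by (intro prod_poly_roots_rational) (auto simp: poly_roots_finite)

lemma algebraic_poly:
  fixes x :: complex
  assumes x: "algebraic x" and g: "g \<in> poly_over \<rat>"
  shows "algebraic (poly g x)"
proof -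
  obtain f where f: "is_min_poly \<rat> f x" using ex_is_min_poly_Rats[OF x] by blast
  have fin: "finite {z. poly f z = 0}" using is_min_poly_nz[OF f] by (rule poly_roots_finite)
  show ?thesis
  proof (rule algebraic_if_root_over_Rats[OF norm_poly_over_Rats[OF f g]])
    show "poly (\<Prod>z\<in>{z. poly f z = 0}. [:- poly g z, 1:]) (poly g x) = 0"
      using fin is_min_polyD(3)[OF f] by (auto simp: poly_prod intro!: prod_zero bexI[of _ x])
  qed (simp add: fin)
qed

text \<open>The point is closure under inverses: \<open>u = g(x)\<close> is algebraic, so its
  inverse is a polynomial in \<open>u\<close>, and composing with \<open>g\<close> makes it one in
  \<open>x\<close>.\<close>

lemma Q_adjoin_singleton:
  assumes x: "algebraic x"
  shows "Q_adjoin {x} = {poly g x |g. g \<in> poly_over \<rat>}" (is "_ = ?K")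
proof (rule antisym)
  note QX = is_subringD[OF is_subring_poly_over[OF is_subring_Rats]]
  have c: "a \<in> ?K" if "a \<in> \<rat>" for a
    using poly_over_const[OF is_subring_Rats that] by (auto intro!: exI[of _ "[:a:]"])
  have "is_subfield ?K"
    unfolding is_subfield_def
  proof (intro conjI ballI)
    fix u v assume "u \<in> ?K" "v \<in> ?K"
    then obtain g h where gh: "g \<in> poly_over \<rat>" "u = poly g x" "h \<in> poly_over \<rat>" "v = poly h x" by auto
    then have "u + v = poly (g + h) x" "u * v = poly (g * h) x" by simp_all
    then show "u + v \<in> ?K" "u * v \<in> ?K" using gh QX by blast+
  next
    fix u assume "u \<in> ?K"
    then obtain g where g: "g \<in> poly_over \<rat>" "u = poly g x" by auto
    then have "- u = poly (- g) x" by simp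
    then show "- u \<in> ?K" using QX(3)[OF g(1)] by blast
    show "inverse u \<in> ?K"
    proof (cases "u = 0")
      case True
      then show ?thesis using c[of 0] by simp
    next
      case False
      then obtain h where "h \<in> poly_over \<rat>" "inverse u = poly h u"
        using inverse_eq_poly algebraic_poly[OF x g(1)] g(2) by blast
      then have "inverse u = poly (pcompose h g) x" "pcompose h g \<in> poly_over \<rat>"
        using g by (auto simp: poly_pcompose intro: poly_over_pcompose is_subring_Rats)
      then show ?thesis by blast
    qed
  qed (use c[of 0] c[of 1] in auto)
  moreover have "x \<in> ?K"
  proof -
    have "[:0, 1 :: complex:] \<in> poly_over \<rat>"
      by (intro poly_over_linear is_subring_Rats) auto
    then show ?thesis by (auto intro!: exI[of _ "[:0, 1:]"])
  qed
  ultimately show "Q_adjoin {x} \<subseteq> ?K" by (intro Q_adjoin_least) auto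
  show "?K \<subseteq> Q_adjoin {x}"
    using subset_Q_adjoin[of "{x}"]
      poly_over_mono[OF Rats_subset_subfield[OF is_subfield_Q_adjoin[of "{x}"]]]
    by (auto intro!: poly_in_subring[OF is_subring_Q_adjoin])
qed

text \<open>The powers of \<open>x\<close> below the degree of \<open>q\<close> form a basis:
  division by \<open>q\<close> gives spanning, minimality of \<open>q\<close> independence.\<close>

lemma Q_degree_Q_adjoin_singleton:
  assumes x: "algebraic x"
  shows "Q_degree (Q_adjoin {x}) = alg_degree x"
proof -
  interpret vs: vector_space rat_scale by (rule vector_space_rat_scale)
  note QX = is_subringD[OF is_subring_poly_over[OF is_subring_Rats]]
  obtain q where q: "is_min_poly \<rat> q x" using ex_is_min_poly_Rats[OF x] by blast
  define n where "n = degree q"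
  let ?K = "Q_adjoin {x}"
  note K = is_subringD[OF is_subring_Q_adjoin[of "{x}"]]
  have no_relation: "c i = 0" if "(\<Sum>i<n. c i * x ^ i) = 0" "\<And>i. c i \<in> \<rat>" "i < n" for c i
  proof -
    define p where "p = (\<Sum>i<n. Polynomial.monom (c i) i)"
    have cp: "coeff p j = (if j < n then c j else 0)" for j
      by (simp add: p_def coeff_sum)
    have "p \<in> poly_over \<rat>" using that(2) by (auto simp: poly_over_def cp)
    moreover have "poly p x = 0" using that(1) by (simp add: p_def poly_sum poly_monom)
    moreover have "degree p < n"
      using cp is_min_poly_degree_pos[OF q] by (intro degree_lessI) (auto simp: n_def)
    ultimately have "p = 0" using is_min_poly_degree_le[OF q] by (force simp: n_def)
    then show "c i = 0" using cp[of i] that(3) by simp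
  qed
  \<comment> \<open>The basis is a set, so its cardinality is \<open>n\<close> only if the powers
    are distinct; a coincidence would itself be a linear relation.\<close>
  have inj: "inj_on (\<lambda>i. x ^ i) {..<n}"
  proof (rule inj_onI, rule ccontr)
    fix i j assume ij: "i \<in> {..<n}" "j \<in> {..<n}" "x ^ i = x ^ j" "i \<noteq> j"
    define c :: "nat \<Rightarrow> complex" where "c = (\<lambda>k. if k = i then 1 else if k = j then - 1 else 0)"
    have "(\<Sum>k<n. c k * x ^ k) = (\<Sum>k\<in>{i, j}. c k * x ^ k)"
      using ij by (intro sum.mono_neutral_right) (auto simp: c_def)
    also have "\<dots> = 0" using ij by (simp add: c_def)
    finally have "c i = 0" using ij by (intro no_relation[of c i]) (auto simp: c_def)
    then show False by (simp add: c_def)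
  qed
  define B where "B = (\<lambda>i. x ^ i) ` {..<n}"
  have sumB: "(\<Sum>v\<in>B. f v) = (\<Sum>i<n. f (x ^ i))" for f :: "complex \<Rightarrow> complex"
    unfolding B_def by (simp add: sum.reindex[OF inj])
  have sub: "vs.subspace ?K"
    using Rats_subset_subfield[OF is_subfield_Q_adjoin[of "{x}"]]
    by (intro vs.subspaceI) (auto intro!: K)
  have "vs.span B = ?K"
  proof (rule vs.span_subspace[OF _ _ sub])
    show "B \<subseteq> ?K"
      using subset_Q_adjoin[of "{x}"] by (auto simp: B_def intro!: is_subring_power[OF is_subring_Q_adjoin])
    show "?K \<subseteq> vs.span B"
    proof
      fix u assume "u \<in> ?K"
      then obtain g where g: "g \<in> poly_over \<rat>" "u = poly g x"
        by (auto simp: Q_adjoin_singleton[OF x])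
      obtain s r where r: "r \<in> poly_over \<rat>" "g = q * s + r" "\<forall>i\<ge>n. coeff r i = 0"
        using poly_over_monic_division[OF is_subring_Rats is_min_polyD(1,2)[OF q] g(1)] n_def by blast
      have "u = poly r x" using g r is_min_polyD(3)[OF q] by simp
      also have "\<dots> = (\<Sum>i<n. coeff r i * x ^ i)"
        unfolding poly_altdef using r(3)
        by (intro sum.mono_neutral_cong) (auto simp: not_less coeff_eq_0)
      also have "\<dots> \<in> vs.span B"
      proof (rule vs.span_sum)
        fix i assume i: "i \<in> {..<n}"
        obtain a where "coeff r i = of_rat a" using poly_overD[OF r(1), of i] by (auto elim: Rats_cases)
        then show "coeff r i * x ^ i \<in> vs.span B"
          using i vs.span_scale[OF vs.span_base, of "x ^ i" B a] by (simp add: B_def)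
      qed
      finally show "u \<in> vs.span B" .
    qed
  qed
  then have "vs.span B = vs.span ?K" using vs.span_eq_iff[THEN iffD2, OF sub] by (simp only:)
  moreover have "\<not> vs.dependent B"
  proof
    assume "vs.dependent B"
    then obtain u where u: "\<exists>v\<in>B. u v \<noteq> 0" "(\<Sum>v\<in>B. of_rat (u v) * v) = 0"
      using vs.dependent_finite[of B] by (auto simp: B_def)
    have "of_rat (u (x ^ i)) = (0 :: complex)" if "i < n" for i
      using u(2) that unfolding sumB by (intro no_relation[where c = "\<lambda>i. of_rat (u (x ^ i))"]) auto
    then show False using u(1) by (auto simp: B_def)
  qed
  ultimately have "vs.dim ?K = card B" by (rule vs.dim_eq_card)
  also have "\<dots> = n" by (simp add: B_def card_image[OF inj])
  finally show ?thesis by (simp add: Q_degree_def alg_degree_eq_degree[OF x q] n_def)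
qed

section \<open>Sums of algebraic numbers and the primitive element theorem\<close>

lemma algebraic_imp_int_multiple_algebraic_int:
  fixes x :: complex
  assumes "algebraic x"
  obtains n :: int where "n \<noteq> 0" "algebraic_int (of_int n * x)"
proof -
  have P: "is_min_int_poly (min_int_poly x) x" by (rule is_min_int_poly_min_int_poly[OF assms])
  have "of_int_poly (min_int_poly x) \<in> poly_over {x :: complex. algebraic_int x}"
    by (rule poly_over_of_int_poly[OF is_subring_algebraic_int])
  from algebraic_int_lead_coeff_mult_root[OF this, of x] P show ?thesis
    by (intro that[of "lead_coeff (min_int_poly x)"]) (auto simp: is_min_int_poly_def)
qed

lemma algebraic_if_int_multiple_algebraic:
  assumes "algebraic (of_int n * x)" "n \<noteq> 0"
  shows "algebraic (x :: complex)"
proof -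
  have "[:0, inverse (of_int n) :: complex:] \<in> poly_over \<rat>"
    by (intro poly_over_linear is_subring_Rats) auto
  from algebraic_poly[OF assms(1) this] show ?thesis using assms(2) by (simp add: field_simps)
qed

text \<open>Clear denominators and add inside the ring of algebraic integers.\<close>

lemma algebraic_add:
  fixes x y :: complex
  assumes "algebraic x" "algebraic y"
  shows "algebraic (x + y)"
proof -
  note O = is_subringD[OF is_subring_algebraic_int, unfolded mem_Collect_eq]
  obtain n m where nm: "n \<noteq> 0" "algebraic_int (of_int n * x)" "m \<noteq> 0" "algebraic_int (of_int m * y)"
    using assms by (metis algebraic_imp_int_multiple_algebraic_int)
  have "algebraic_int (of_int m * (of_int n * x) + of_int n * (of_int m * y))"
    by (intro O(4) O(5)[OF _ nm(2)] O(5)[OF _ nm(4)] algebraic_int_of_int)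
  then have "algebraic_int (of_int (m * n) * (x + y))" by (simp add: algebra_simps)
  from algebraic_int_imp_algebraic[OF this] show ?thesis
    by (rule algebraic_if_int_multiple_algebraic) (use nm in simp)
qed

lemma algebraic_of_nat_mult:
  assumes "algebraic (x :: complex)"
  shows "algebraic (of_nat n * x)"
proof -
  have "[:0, of_nat n :: complex:] \<in> poly_over \<rat>"
    by (intro poly_over_linear is_subring_Rats) auto
  from algebraic_poly[OF assms(1) this] show ?thesis by (simp add: mult.commute)
qed

text \<open>With \<open>t = a + c b\<close>, the polynomials \<open>g(X)\<close> and
  \<open>f(t - c X)\<close> over \<rat>(t) share the root \<open>b\<close>. For all but finitely
  many \<open>c\<close> it is their only common root, so \<open>b\<close>, and then
  \<open>a\<close>, lies in \<rat>(t).\<close>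

lemma primitive_element_two:
  assumes a: "algebraic a" and b: "algebraic b"
  shows "\<exists>t. algebraic t \<and> Q_adjoin {a, b} = Q_adjoin {t}"
proof -
  obtain f where f: "is_min_poly \<rat> f a" using ex_is_min_poly_Rats[OF a] by blast
  obtain g where g: "is_min_poly \<rat> g b" using ex_is_min_poly_Rats[OF b] by blast
  \<comment> \<open>These are the \<open>c\<close> for which another root \<open>v\<close> of
    \<open>g\<close> satisfies \<open>t - c v = u\<close> with \<open>u\<close> a root of
    \<open>f\<close>. The pairs with \<open>v = b\<close> contribute the default value 0 of division
    by zero.\<close>
  define bad where "bad = (\<lambda>(u, v). (u - a) / (b - v)) ` ({z. poly f z = 0} \<times> {z. poly g z = 0})"
  have "finite bad"
    using is_min_poly_nz[OF f] is_min_poly_nz[OF g] by (simp add: bad_def poly_roots_finite)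
  moreover have "infinite (range (of_nat :: nat \<Rightarrow> complex))"
    by (simp add: finite_image_iff inj_on_def)
  ultimately obtain c :: nat where c: "of_nat c \<notin> bad"
    by (metis finite_subset image_subsetI)
  define t where "t = a + of_nat c * b"
  have t: "algebraic t" unfolding t_def by (intro algebraic_add a algebraic_of_nat_mult b)
  define F where "F = Q_adjoin {t}"
  have F: "is_subfield F" unfolding F_def by (rule is_subfield_Q_adjoin)
  note R = is_subfield_imp_subring[OF F]
  have over: "poly_over \<rat> \<subseteq> poly_over F" by (rule poly_over_mono[OF Rats_subset_subfield[OF F]])
  have tF: "t \<in> F" using subset_Q_adjoin[of "{t}"] by (simp add: F_def)
  have "b \<in> F"
  proof (rule unique_common_root_in_subfield[OF F])
    show "g \<in> poly_over F" "g \<noteq> 0" "poly g b = 0"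
      using over is_min_polyD[OF g] is_min_poly_nz[OF g] by auto
    have "[:t, - of_nat c:] \<in> poly_over F"
      by (intro poly_over_linear R tF is_subringD(3)[OF R] is_subring_of_nat)
    then show "pcompose f [:t, - of_nat c:] \<in> poly_over F"
      using over is_min_polyD(1)[OF f] by (intro poly_over_pcompose R) auto
    show "poly (pcompose f [:t, - of_nat c:]) b = 0"
      using is_min_polyD(3)[OF f] by (simp add: poly_pcompose t_def)
    fix z assume z: "poly g z = 0" "poly (pcompose f [:t, - of_nat c:]) z = 0"
    show "z = b"
    proof (rule ccontr)
      assume "z \<noteq> b"
      moreover define u where "u = t - of_nat c * z"
      ultimately have "of_nat c = (u - a) / (b - z)" by (simp add: t_def field_simps)
      moreover have "poly f u = 0" using z(2) by (simp add: poly_pcompose u_def algebra_simps)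
      ultimately have "of_nat c \<in> bad" unfolding bad_def using z(1) by (intro image_eqI[of _ _ "(u, z)"]) auto
      then show False using c by simp
    qed
  qed
  moreover from this have "t - of_nat c * b \<in> F"
    by (intro is_subringD[OF R] tF is_subring_of_nat R)
  then have "a \<in> F" by (simp add: t_def)
  ultimately have "Q_adjoin {a, b} \<subseteq> F" unfolding F_def Q_adjoin_subset_iff by simp
  moreover have "t \<in> Q_adjoin {a, b}"
    using subset_Q_adjoin[of "{a, b}"] unfolding t_def
    by (intro is_subringD[OF is_subring_Q_adjoin] is_subring_of_nat[OF is_subring_Q_adjoin]) auto
  then have "F \<subseteq> Q_adjoin {a, b}" unfolding F_def Q_adjoin_subset_iff by simp
  ultimately show ?thesis using t by (auto simp: F_def)
qed

lemma primitive_element: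
  assumes "finite S" "\<And>x. x \<in> S \<Longrightarrow> algebraic x"
  shows "\<exists>t. algebraic t \<and> Q_adjoin S = Q_adjoin {t}"
  using assms
proof (induction S rule: finite_induct)
  case empty
  have "0 \<in> Q_adjoin {}" by (rule is_subringD(1)[OF is_subring_Q_adjoin])
  then have "Q_adjoin {} = Q_adjoin {0}"
    by (intro antisym) (simp_all add: Q_adjoin_subset_iff)
  then show ?case by auto
next
  case (insert a S)
  then obtain s where s: "algebraic s" "Q_adjoin S = Q_adjoin {s}" by auto
  have "S \<subseteq> Q_adjoin T \<longleftrightarrow> {s} \<subseteq> Q_adjoin T" for T
    using s(2) Q_adjoin_subset_iff by metis
  then have "Q_adjoin (insert a S) \<subseteq> Q_adjoin T \<longleftrightarrow> Q_adjoin {a, s} \<subseteq> Q_adjoin T" for T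
    unfolding Q_adjoin_subset_iff by auto
  then have "Q_adjoin (insert a S) = Q_adjoin {a, s}" by (meson antisym order_refl)
  then show ?case using primitive_element_two[of a s] insert.prems s(1) by auto
qed

subsection \<open>Heights of integral linear combinations\<close>

text \<open>Choose the coordinates one after another. Each condition excludes at most one value of
  the last coordinate on which it depends, so fewer than \<open>card C\<close> conditions leave a
  value free.\<close>

lemma avoid_hyperplanes:
  fixes v :: "'z \<Rightarrow> 'i \<Rightarrow> complex" and C :: "int set"
  assumes "finite I" "finite Z" "card Z < card C" "\<And>z. z \<in> Z \<Longrightarrow> \<exists>i\<in>I. v z i \<noteq> 0"
  shows "\<exists>c. (\<forall>i\<in>I. c i \<in> C) \<and> (\<forall>z\<in>Z. (\<Sum>i\<in>I. of_int (c i) * v z i) \<noteq> 0)"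
  using assms
proof (induction I arbitrary: Z rule: finite_induct)
  case empty
  then show ?case by auto
next
  case (insert i I)
  \<comment> \<open>Only conditions that already involve a coordinate in \<open>I\<close> can be
    imposed on \<open>c'\<close>; the others depend on coordinate \<open>i\<close> alone.\<close>
  define Z' where "Z' = {z\<in>Z. \<exists>j\<in>I. v z j \<noteq> 0}"
  have fin: "finite C" using insert.prems(2) by (metis card.infinite less_nat_zero_code)
  have Z': "finite Z'" "card Z' < card C"
    using insert.prems card_mono[of Z Z'] by (auto simp: Z'_def)
  obtain c' where c': "\<And>j. j \<in> I \<Longrightarrow> c' j \<in> C" "\<And>z. z \<in> Z' \<Longrightarrow> (\<Sum>j\<in>I. of_int (c' j) * v z j) \<noteq> 0"
    using insert.IH[OF Z'] by (auto simp: Z'_def)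
  define s where "s = (\<lambda>z. \<Sum>j\<in>I. of_int (c' j) * v z j)"
  define B where "B = (\<lambda>z. {n\<in>C. v z i \<noteq> 0 \<and> of_int n * v z i + s z = 0})"
  have "card (B z) \<le> 1" for z
  proof -
    have "n = k" if "n \<in> B z" "k \<in> B z" for n k
    proof -
      have "of_int n * v z i = of_int k * v z i" "v z i \<noteq> 0"
        using that by (auto simp: B_def add_eq_0_iff2)
      then show ?thesis by simp
    qed
    moreover have "finite (B z)" using fin by (simp add: B_def)
    ultimately show ?thesis by (simp add: card_le_Suc0_iff_eq)
  qed
  then have "card (\<Union>z\<in>Z. B z) \<le> (\<Sum>z\<in>Z. 1)"
    using insert.prems(1) by (intro order.trans[OF card_UN_le] sum_mono) auto
  then have "card (\<Union>z\<in>Z. B z) < card C" using insert.prems(2) by simp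
  then have "\<not> C \<subseteq> (\<Union>z\<in>Z. B z)"
    using card_mono[of "\<Union>z\<in>Z. B z" C] insert.prems(1) fin by (auto simp: B_def)
  then obtain n where n: "n \<in> C" "\<And>z. z \<in> Z \<Longrightarrow> n \<notin> B z" by blast
  have sum_eq: "(\<Sum>j\<in>insert i I. of_int ((c'(i := n)) j) * v z j) = of_int n * v z i + s z" for z
  proof -
    have "(\<Sum>j\<in>I. of_int ((c'(i := n)) j) * v z j) = s z"
      unfolding s_def using insert.hyps by (intro sum.cong) auto
    then show ?thesis using insert.hyps by simp
  qed
  have "of_int n * v z i + s z \<noteq> 0" if z: "z \<in> Z" for z
  proof (cases "v z i = 0")
    \<comment> \<open>The condition does not see the new coordinate, so it is nontrivial on
      \<open>I\<close> and \<open>c'\<close> meets it already.\<close>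
    case True
    then have "z \<in> Z'" using z insert.prems(3)[OF z] by (auto simp: Z'_def)
    then show ?thesis using c'(2) True by (simp add: s_def)
  next
    case False
    then show ?thesis using n z by (auto simp: B_def)
  qed
  then show ?case
    using c'(1) n(1) by (intro exI[of _ "c'(i := n)"]) (simp only: sum_eq, auto)
qed

section \<open>Conjugates and norms\<close>

lemma poly_conjugate_root:
  assumes f: "is_min_poly \<rat> f x" and z: "poly f z = 0" and h: "h \<in> poly_over \<rat>" "poly h x = 0"
  shows "poly h z = 0"
  using is_min_polyD(4)[OF f h] z by (auto elim!: dvdE)

text \<open>The composite of \<open>q\<close> with \<open>g\<close> vanishes at \<open>x\<close>,
  hence at every conjugate \<open>z\<close>, so all roots \<open>g(z)\<close> of the norm are roots
  of \<open>q\<close>. The exponent \<open>k\<close> is the degree of \<rat>(x) over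
  \<rat>(g(x)).\<close>

lemma norm_eq_power_of_min_poly:
  assumes f: "is_min_poly \<rat> f x" and g: "g \<in> poly_over \<rat>" and q: "is_min_poly \<rat> q (poly g x)"
  shows "\<exists>k. (\<Prod>z\<in>{z. poly f z = 0}. [:- poly g z, 1:]) = q ^ k \<and> k * degree q = degree f"
proof -
  let ?R = "{z. poly f z = 0}" and ?p = "\<Prod>z\<in>{z. poly f z = 0}. [:- poly g z, 1:]"
  have fin: "finite ?R" using is_min_poly_nz[OF f] by (rule poly_roots_finite)
  have "pcompose q g \<in> poly_over \<rat>"
    using is_min_polyD(1)[OF q] g by (intro poly_over_pcompose is_subring_Rats)
  moreover have "poly (pcompose q g) x = 0" using is_min_polyD(3)[OF q] by (simp add: poly_pcompose)
  ultimately have conj: "poly q (poly g z) = 0" if "poly f z = 0" for z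
    using poly_conjugate_root[OF f that, of "pcompose q g"] by (simp add: poly_pcompose)
  have "\<exists>k. ?p = q ^ k"
  proof (rule power_of_min_poly[OF is_subfield_Rats q norm_poly_over_Rats[OF f g]])
    show "lead_coeff ?p = 1" unfolding lead_coeff_prod by simp
    show "poly q y = 0" if "poly ?p y = 0" for y
      using that fin conj by (auto simp: poly_prod)
  qed
  then obtain k where k: "?p = q ^ k" by blast
  have "degree ?p = degree f"
    using is_min_poly_roots(1)[OF is_subfield_Rats f]
    by (subst degree_prod_eq_sum_degree) auto
  then have "k * degree q = degree f"
    unfolding k by (simp add: degree_power_eq is_min_poly_nz[OF q] mult.commute)
  then show ?thesis using k by blast
qed

lemma min_int_poly_power_eq_norm:
  assumes x: "algebraic x" and f: "is_min_poly \<rat> f x" and g: "g \<in> poly_over \<rat>"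
  obtains k where "k * alg_degree (poly g x) = degree f"
    "of_int_poly (min_int_poly (poly g x) ^ k) =
      Polynomial.smult (of_int (lead_coeff (min_int_poly (poly g x)) ^ k))
        (\<Prod>z\<in>{z. poly f z = 0}. [:- poly g z, 1:])"
proof -
  note y = algebraic_poly[OF x g]
  obtain q where q: "is_min_poly \<rat> q (poly g x)" using ex_is_min_poly_Rats[OF y] by blast
  obtain k where k: "(\<Prod>z\<in>{z. poly f z = 0}. [:- poly g z, 1:]) = q ^ k" "k * degree q = degree f"
    using norm_eq_power_of_min_poly[OF f g q] by blast
  show ?thesis
    by (rule that[of k]) (use k in \<open>simp_all add: alg_degree_eq_degree[OF y q] of_int_poly_hom.hom_power
      min_int_poly_eq_smult[OF y q] smult_power\<close>)
qed

section \<open>Mahler measures as products over conjugates\<close>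

lemma mahler_measure_poly_smult_prod:
  assumes "finite R"
  shows "mahler_measure_poly (Polynomial.smult c (\<Prod>z\<in>R. [:- w z, 1:])) = cmod c * (\<Prod>z\<in>R. max 1 (cmod (w z)))"
proof -
  obtain zs where zs: "set zs = R" "distinct zs" using finite_distinct_list[OF assms] by blast
  have "(\<Prod>z\<in>R. [:- w z, 1:]) = (\<Prod>a\<leftarrow>map w zs. [:- a, 1:])"
    using zs by (simp add: prod.distinct_set_conv_list[symmetric] o_def)
  moreover have "(\<Prod>z\<in>R. max 1 (cmod (w z))) = (\<Prod>a\<leftarrow>map w zs. max 1 (cmod a))"
    using zs by (simp add: prod.distinct_set_conv_list[symmetric] o_def)
  ultimately show ?thesis using mahler_measure_poly_explicit[of c "map w zs"] by simp
qed

lemma mahler_measure_poly_power: "mahler_measure_poly (p ^ k) = mahler_measure_poly p ^ k"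
proof -
  have "mahler_measure_poly (p ^ k) = mahler_measure_poly p ^ k" if p: "p \<noteq> 0"
  proof -
    have "mahler_measure_monic (p ^ k) = mahler_measure_monic p ^ k"
    proof (induction k)
      case 0
      have "mahler_measure_poly [:1:] = 1" by (simp only: mahler_measure_constant norm_one)
      then show ?case by (simp add: mahler_measure_poly_via_monic pCons_one)
    next
      case (Suc k)
      then show ?case using p by (simp add: measure_mono_eq_prod)
    qed
    then show ?thesis
      by (simp add: mahler_measure_poly_via_monic lead_coeff_power norm_power power_mult_distrib)
  qed
  moreover have "mahler_measure_poly (0 ^ k) = mahler_measure_poly 0 ^ k"
    using mahler_measure_constant[of 1] by (cases k) (simp_all add: pCons_one)
  ultimately show ?thesis by (cases "p = 0") simp_all
qed

lemma alg_mahler_power_eq: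
  assumes "finite R"
    and "of_int_poly (min_int_poly y ^ k) =
      Polynomial.smult (of_int (lead_coeff (min_int_poly y) ^ k)) (\<Prod>z\<in>R. [:- w z, 1:])"
    and "algebraic y"
  shows "alg_mahler y ^ k = of_int (lead_coeff (min_int_poly y) ^ k) * (\<Prod>z\<in>R. max 1 (cmod (w z)))"
proof -
  have "lead_coeff (min_int_poly y) > 0"
    using is_min_int_poly_min_int_poly[OF assms(3)] by (simp add: is_min_int_poly_def)
  then have "cmod (of_int (lead_coeff (min_int_poly y) ^ k)) = of_int (lead_coeff (min_int_poly y) ^ k)"
    by (simp add: norm_power)
  moreover have "alg_mahler y ^ k = mahler_measure_poly (of_int_poly (min_int_poly y ^ k))"
    by (simp add: alg_mahler_def mahler_measure_def of_int_poly_hom.hom_power mahler_measure_poly_power)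
  ultimately show ?thesis
    unfolding assms(2) mahler_measure_poly_smult_prod[OF assms(1)] by simp
qed

text \<open>Expanding the product over the conjugates, every coefficient is an integral combination of
  terms that pick one \<open>w i z\<close> (or 1) for each \<open>z\<close>; grouping the picks by \<open>i\<close> gives products over
  disjoint subsets of the conjugates, which are integral after scaling.\<close>

lemma norm_linear_combination_integral:
  fixes w :: "nat \<Rightarrow> 'z \<Rightarrow> complex" and c :: "nat \<Rightarrow> int" and N :: "nat \<Rightarrow> complex"
  assumes R: "finite R"
    and int: "\<And>i T. i \<in> {1..m} \<Longrightarrow> T \<subseteq> R \<Longrightarrow> algebraic_int (N i * (\<Prod>z\<in>T. w i z))"
  shows "Polynomial.smult (\<Prod>i=1..m. N i) (\<Prod>z\<in>R. [:- (\<Sum>i=1..m. of_int (c i) * w i z), 1:])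
    \<in> poly_over {x. algebraic_int x}"
proof -
  note O = is_subring_algebraic_int
  \<comment> \<open>Index 0 stands for picking the variable \<open>X\<close>, with weight 1, so that
    each linear factor becomes a uniform sum over \<open>{0..m}\<close>.\<close>
  define u :: "nat \<Rightarrow> complex poly" where "u = (\<lambda>i. if i = 0 then [:0, 1:] else [:- of_int (c i):])"
  define w' where "w' = (\<lambda>i z. if i = 0 then 1 else w i z)"
  have u: "u i \<in> poly_over {x. algebraic_int x}" for i
    using poly_over_linear[OF O, of 0 1] poly_over_const[OF O, of "- of_int (c i)"] by (simp add: u_def)
  have lin: "[:- (\<Sum>i=1..m. of_int (c i) * w i z), 1:] = (\<Sum>i=0..m. Polynomial.smult (w' i z) (u i))" for z
  proof -
    have "(\<Sum>i=1..m. Polynomial.smult (w' i z) (u i)) = (\<Sum>i=1..m. [:- (of_int (c i) * w i z):])"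
      by (intro sum.cong) (auto simp: w'_def u_def)
    also have "\<dots> = [:- (\<Sum>i=1..m. of_int (c i) * w i z):]"
      by (induction m) simp_all
    finally show ?thesis
      by (simp add: sum.atLeast_Suc_atMost w'_def u_def)
  qed
  have "Polynomial.smult (\<Prod>i=1..m. N i) (\<Prod>z\<in>R. [:- (\<Sum>i=1..m. of_int (c i) * w i z), 1:])
      = Polynomial.smult (\<Prod>i=1..m. N i)
          (\<Sum>p\<in>R \<rightarrow>\<^sub>E {0..m}. \<Prod>z\<in>R. Polynomial.smult (w' (p z) z) (u (p z)))"
    unfolding lin by (subst prod_sum_PiE) (use R in auto)
  also have "\<dots> = (\<Sum>p\<in>R \<rightarrow>\<^sub>E {0..m}.
      Polynomial.smult ((\<Prod>i=1..m. N i) * (\<Prod>z\<in>R. w' (p z) z)) (\<Prod>z\<in>R. u (p z)))"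
    by (simp add: smult_sum2 prod_smult)
  also have "\<dots> \<in> poly_over {x. algebraic_int x}"
  proof (intro is_subring_sum is_subring_poly_over O poly_over_smult is_subring_prod[OF is_subring_poly_over[OF O]] u)
    fix p assume p: "p \<in> R \<rightarrow>\<^sub>E {0..m}"
    have "(\<Prod>z\<in>R. w' (p z) z) = (\<Prod>i=0..m. \<Prod>z\<in>{z\<in>R. p z = i}. w' i z)"
      using p R by (subst prod.group[symmetric, of R "{0..m}" p]) auto
    also have "\<dots> = (\<Prod>i=1..m. \<Prod>z\<in>{z\<in>R. p z = i}. w i z)"
      by (simp add: prod.atLeast_Suc_atMost w'_def)
    finally have "(\<Prod>i=1..m. N i) * (\<Prod>z\<in>R. w' (p z) z) = (\<Prod>i=1..m. N i * (\<Prod>z\<in>{z\<in>R. p z = i}. w i z))"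
      by (simp add: prod.distrib)
    also have "\<dots> \<in> {x. algebraic_int x}"
      using int by (intro is_subring_prod[OF O]) auto
    finally show "(\<Prod>i=1..m. N i) * (\<Prod>z\<in>R. w' (p z) z) \<in> {x. algebraic_int x}" .
  qed
  finally show ?thesis .
qed

text \<open>The coefficients of \<open>N q\<close> are rational algebraic integers, hence integers.
  The minimal polynomial is \<open>a q\<close>, so \<open>a\<close> divides \<open>N\<close> times
  each of its coefficients; as these have content 1, \<open>a\<close> divides
  \<open>N\<close>.\<close>

lemma lead_coeff_min_int_poly_le:
  fixes N :: int
  assumes y: "algebraic y" and q: "is_min_poly \<rat> q y" and N: "N > 0"
    and int: "Polynomial.smult (of_int N) q \<in> poly_over {x. algebraic_int x}"
  shows "lead_coeff (min_int_poly y) \<le> N"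
proof -
  define P a where "P = min_int_poly y" and "a = lead_coeff P"
  have P: "content P = 1" and a: "a > 0"
    using is_min_int_poly_min_int_poly[OF y] by (auto simp: P_def a_def is_min_int_poly_def)
  have "coeff (Polynomial.smult (of_int N) q) i \<in> \<int>" for i
    using poly_overD[OF int, of i] poly_overD[OF is_min_polyD(1)[OF q], of i]
    by (intro rational_algebraic_int_is_int) auto
  then have "\<forall>i. \<exists>b. coeff (Polynomial.smult (of_int N) q) i = of_int b"
    by (auto elim: Ints_cases)
  then obtain b where b: "\<And>i. of_int N * coeff q i = of_int (b i)"
    by (auto dest: choice)
  have cP: "of_int (coeff P i) = of_int a * coeff q i" for i
    using arg_cong[OF min_int_poly_eq_smult[OF y q], of "\<lambda>p. coeff p i"] by (simp add: P_def a_def)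
  have "a dvd coeff (Polynomial.smult N P) i" for i
  proof -
    have "(of_int (N * coeff P i) :: complex) = of_int (a * b i)"
      using cP[of i] b[of i] by (simp add: mult.left_commute)
    then have "N * coeff P i = a * b i" by (simp only: of_int_eq_iff)
    then show ?thesis by simp
  qed
  then have "a dvd content (Polynomial.smult N P)"
    by (simp only: const_poly_dvd_iff_dvd_content[symmetric] const_poly_dvd_iff) blast
  then have "a dvd N" using P N by (simp add: content_smult)
  then show ?thesis using N by (auto simp: P_def a_def dest: zdvd_imp_le)
qed

section \<open>Generators among small integral combinations\<close>

text \<open>The elements fixed by the embedding that sends \<open>x\<close> to \<open>z\<close> form
  a field. It contains \<open>S\<close>, hence \<open>x\<close>, so the embedding fixes
  \<open>x\<close>.\<close>

lemma conjugate_fixing_generators: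
  assumes x: "algebraic x" and f: "is_min_poly \<rat> f x" and z: "poly f z = 0"
    and gen: "x \<in> Q_adjoin S"
    and S: "\<And>a. a \<in> S \<Longrightarrow> \<exists>h\<in>poly_over \<rat>. poly h x = a \<and> poly h z = a"
  shows "z = x"
proof -
  note QX = is_subringD[OF is_subring_poly_over[OF is_subring_Rats]]
  define E where "E = {poly h x |h. h \<in> poly_over \<rat> \<and> poly h z = poly h x}"
  have E: "poly h x \<in> E" if "h \<in> poly_over \<rat>" "poly h z = poly h x" for h
    using that by (auto simp: E_def)
  have "is_subfield E"
    unfolding is_subfield_def
  proof (intro conjI ballI)
    show "0 \<in> E" "1 \<in> E" using E[of 0] E[of 1] QX(1,2) by auto
    fix u v assume "u \<in> E" "v \<in> E"
    then obtain g h where "g \<in> poly_over \<rat>" "poly g z = poly g x" "u = poly g x"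
      "h \<in> poly_over \<rat>" "poly h z = poly h x" "v = poly h x" by (auto simp: E_def)
    then show "u + v \<in> E" "u * v \<in> E"
      using E[of "g + h"] E[of "g * h"] QX(4,5)[of g h] by auto
  next
    fix u assume "u \<in> E"
    then obtain g where g: "g \<in> poly_over \<rat>" "poly g z = poly g x" "u = poly g x"
      by (auto simp: E_def)
    then show "- u \<in> E" using E[of "- g"] QX(3)[of g] by auto
    show "inverse u \<in> E"
    proof (cases "u = 0")
      case True
      then show ?thesis using E[of 0] QX(1) by auto
    next
      case False
      have "inverse u \<in> Q_adjoin {x}"
        using g Q_adjoin_singleton[OF x] by (intro is_subfield_inverse[OF is_subfield_Q_adjoin]) auto
      then obtain p where p: "p \<in> poly_over \<rat>" "inverse u = poly p x"
        by (auto simp: Q_adjoin_singleton[OF x])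
      \<comment> \<open>The relation \<open>p(x) g(x) = 1\<close> passes to \<open>z\<close>, where
        \<open>g(z) = u\<close>.\<close>
      have "poly (p * g - 1) z = 0"
        using p g False by (intro poly_conjugate_root[OF f z]) (auto simp: QX simp flip: p(2))
      then have "poly p z = inverse u" using g False by (simp add: field_simps)
      then show ?thesis using E[of p] p by simp
    qed
  qed
  moreover have "S \<subseteq> E" using S E by force
  ultimately have "x \<in> E" using gen Q_adjoin_least by blast
  then obtain h where h: "h \<in> poly_over \<rat>" "poly h z = poly h x" "poly h x = x"
    by (auto simp: E_def)
  \<comment> \<open>The relation \<open>h(x) = x\<close> passes to \<open>h(z) = z\<close>, while
    membership in \<open>E\<close> gives \<open>h(z) = x\<close>.\<close>
  have "poly (h - [:0, 1:]) z = 0"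
    using h by (intro poly_conjugate_root[OF f z] QX poly_over_linear is_subring_Rats) auto
  then show ?thesis using h by simp
qed

text \<open>All factors of the product \<open>W\<close> are at least 1, so every
  \<open>cmod (w i)\<close> is at most \<open>W\<close>, and \<open>m\<close> terms of size at most
  \<open>b * W\<close> remain. Since \<open>m\<close> and \<open>b\<close> are positive, the bound
  also absorbs the 1 in the maximum.\<close>

lemma max_norm_linear_combination_le:
  fixes w :: "nat \<Rightarrow> complex" and c :: "nat \<Rightarrow> int"
  assumes m: "m \<ge> 1" and b: "b \<ge> (1 :: nat)" and c: "\<And>i. i \<in> {1..m} \<Longrightarrow> \<bar>c i\<bar> \<le> int b"
  shows "max 1 (cmod (\<Sum>i=1..m. of_int (c i) * w i)) \<le> real (m * b) * (\<Prod>i=1..m. max 1 (cmod (w i)))"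
proof -
  define W where "W = (\<Prod>i=1..m. max 1 (cmod (w i)))"
  have W1: "W \<ge> 1" unfolding W_def by (intro prod_ge_1) auto
  have "cmod (of_int (c i) * w i) \<le> real b * W" if i: "i \<in> {1..m}" for i
  proof -
    have "(\<Prod>j\<in>{i}. max 1 (cmod (w j))) \<le> W"
      unfolding W_def using i by (intro prod_mono2) auto
    then have "cmod (w i) \<le> W" by simp
    moreover have "real_of_int \<bar>c i\<bar> \<le> real b" using c[OF i] by linarith
    ultimately show ?thesis unfolding norm_mult norm_of_int by (intro mult_mono) auto
  qed
  then have "(\<Sum>i=1..m. cmod (of_int (c i) * w i)) \<le> (\<Sum>i=1..m. real b * W)"
    by (rule sum_mono)
  then have "cmod (\<Sum>i=1..m. of_int (c i) * w i) \<le> real (m * b) * W"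
    using norm_sum[of "\<lambda>i. of_int (c i) * w i" "{1..m}"] by simp
  moreover have "1 * 1 \<le> real (m * b) * W"
    using m b W1 by (intro mult_mono) (auto simp: Suc_le_eq simp flip: of_nat_mult)
  ultimately show ?thesis by (simp add: W_def)
qed

lemma alg_mahler_ge_1:
  assumes "algebraic x"
  shows "alg_mahler x \<ge> 1"
proof -
  have "min_int_poly x \<noteq> 0"
    using is_min_int_poly_min_int_poly[OF assms] by (auto simp: is_min_int_poly_def)
  then show ?thesis unfolding alg_mahler_def by (rule mahler_measure_poly_ge_1)
qed

text \<open>Avoiding the hyperplanes makes the combination \<open>y = G(x)\<close> differ from
  \<open>G(z)\<close> for every other conjugate \<open>z\<close>. Then \<open>x\<close> is the only
  common root of \<open>f\<close> and \<open>G - y\<close>, which puts it into \<rat>(y).\<close>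

lemma ex_generating_linear_combination:
  fixes m :: nat
  assumes x: "algebraic x" and f: "is_min_poly \<rat> f x"
    and g: "\<And>i. i \<in> {1..m} \<Longrightarrow> g i \<in> poly_over \<rat>"
    and gen: "Q_adjoin ((\<lambda>i. poly (g i) x) ` {1..m}) = Q_adjoin {x}"
  shows "\<exists>c. (\<forall>i\<in>{1..m}. \<bar>c i\<bar> \<le> int (degree f div 2)) \<and>
    Q_adjoin {\<Sum>i=1..m. of_int (c i) * poly (g i) x} = Q_adjoin {x}"
proof -
  define d R b where "d = degree f" and "R = {z. poly f z = 0}" and "b = int (d div 2)"
  have fin: "finite R" unfolding R_def using is_min_poly_nz[OF f] by (rule poly_roots_finite)
  have cardR: "card R = d" unfolding R_def d_def by (rule is_min_poly_roots(1)[OF is_subfield_Rats f])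
  have xR: "x \<in> R" using is_min_polyD(3)[OF f] by (simp add: R_def)
  have "d > 0" unfolding d_def by (rule is_min_poly_degree_pos[OF f])
  \<comment> \<open>There are \<open>d - 1\<close> conditions and
    \<open>2 * (d div 2) + 1 \<ge> d\<close> values; \<open>d > 0\<close> makes the inequality
    strict.\<close>
  then have card: "card (R - {x}) < card {- b..b}"
    using cardR xR fin by (simp add: b_def)
  \<comment> \<open>A vanishing linear form would mean that the embedding given by \<open>z\<close>
    fixes every generator.\<close>
  have nonzero: "\<exists>i\<in>{1..m}. poly (g i) z - poly (g i) x \<noteq> 0" if z: "z \<in> R - {x}" for z
  proof (rule ccontr)
    assume neg: "\<not> ?thesis"
    have "z = x"
    proof (rule conjugate_fixing_generators[OF x f])
      show "poly f z = 0" using z by (simp add: R_def)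
      show "x \<in> Q_adjoin ((\<lambda>i. poly (g i) x) ` {1..m})" using gen subset_Q_adjoin[of "{x}"] by simp
      show "\<exists>h\<in>poly_over \<rat>. poly h x = a \<and> poly h z = a" if "a \<in> (\<lambda>i. poly (g i) x) ` {1..m}" for a
        using that g neg by auto
    qed
    then show False using z by simp
  qed
  obtain c where c: "\<And>i. i \<in> {1..m} \<Longrightarrow> c i \<in> {- b..b}"
    "\<And>z. z \<in> R - {x} \<Longrightarrow> (\<Sum>i=1..m. of_int (c i) * (poly (g i) z - poly (g i) x)) \<noteq> 0"
    using avoid_hyperplanes[where v = "\<lambda>z i. poly (g i) z - poly (g i) x",
        OF finite_atLeastAtMost finite_Diff[OF fin] card nonzero] by blast
  define G y where "G = (\<Sum>i=1..m. Polynomial.smult (of_int (c i)) (g i))" and "y = poly G x"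
  have G: "G \<in> poly_over \<rat>"
    unfolding G_def using g
    by (intro is_subring_sum is_subring_poly_over poly_over_smult is_subring_Rats) auto
  have polyG: "poly G z = (\<Sum>i=1..m. of_int (c i) * poly (g i) z)" for z
    by (simp add: G_def poly_sum)
  have F: "is_subfield (Q_adjoin {y})" by (rule is_subfield_Q_adjoin)
  note over = subsetD[OF poly_over_mono[OF Rats_subset_subfield[OF F]]]
  note RX = is_subringD[OF is_subring_poly_over[OF is_subring_Q_adjoin]]
  have "x \<in> Q_adjoin {y}"
  proof (rule unique_common_root_in_subfield[OF F])
    show "f \<in> poly_over (Q_adjoin {y})" "f \<noteq> 0" "poly f x = 0"
      using over is_min_polyD[OF f] is_min_poly_nz[OF f] by auto
    show "G - [:y:] \<in> poly_over (Q_adjoin {y})"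
      using subset_Q_adjoin[of "{y}"]
      by (intro RX over[OF G] poly_over_const is_subring_Q_adjoin) auto
    show "poly (G - [:y:]) x = 0" by (simp add: y_def)
    show "z = x" if "poly f z = 0" "poly (G - [:y:]) z = 0" for z
      using c(2)[of z] that
      by (auto simp: R_def y_def polyG right_diff_distrib sum_subtractf)
  qed
  moreover have "y \<in> Q_adjoin {x}" unfolding Q_adjoin_singleton[OF x] y_def using G by blast
  ultimately have "Q_adjoin {y} = Q_adjoin {x}"
    by (intro antisym) (simp_all add: Q_adjoin_subset_iff)
  then show ?thesis
    using c(1) by (intro exI[of _ c]) (auto simp: y_def polyG b_def d_def abs_le_iff minus_le_iff)
qed

section \<open>A generator of the number field of small height\<close>

theorem theorem2p1:
  fixes m d :: nat
    and \<alpha> :: "nat \<Rightarrow> complex"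
    and \<delta> :: "nat \<Rightarrow> nat"
    and K :: "complex set"
  assumes m: "m \<ge> 1"
    and alg: "\<And>i. i \<in> {1..m} \<Longrightarrow> algebraic (\<alpha> i)"
    and deg: "\<And>i. i \<in> {1..m} \<Longrightarrow> alg_degree (\<alpha> i) = \<delta> i"
    and deg_ge: "\<And>i. i \<in> {1..m} \<Longrightarrow> \<delta> i \<ge> 2"
    and K: "K = Q_adjoin (\<alpha> ` {1..m})"
    and d: "Q_degree K = d"
  shows "\<exists>\<beta>\<in>K. algebraic \<beta> \<and> K = Q_adjoin {\<beta>} \<and>
           log_height \<beta> \<le> ln (real (m * (d div 2))) + (\<Sum>i=1..m. log_height (\<alpha> i)) \<and>
           alg_mahler \<beta> \<le> real (m * (d div 2)) ^ d *
             (\<Prod>i=1..m. alg_mahler (\<alpha> i) powr (real d / real (\<delta> i)))"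
proof -
  obtain \<theta> where \<theta>: "algebraic \<theta>" and K\<theta>: "K = Q_adjoin {\<theta>}"
    using primitive_element[OF finite_imageI[OF finite_atLeastAtMost], of \<alpha> 1 m] alg K by blast
  obtain f where f: "is_min_poly \<rat> f \<theta>" using ex_is_min_poly_Rats[OF \<theta>] by blast
  define R where "R = {z. poly f z = 0}"
  have fin: "finite R" unfolding R_def using is_min_poly_nz[OF f] by (rule poly_roots_finite)
  have df: "degree f = d"
    using d K\<theta> Q_degree_Q_adjoin_singleton[OF \<theta>] alg_degree_eq_degree[OF \<theta> f] by simp
  have cardR: "card R = d"
    unfolding R_def using is_min_poly_roots(1)[OF is_subfield_Rats f] df by simp
  have d0: "d > 0" using is_min_poly_degree_pos[OF f] df by simp

  have "\<exists>h\<in>poly_over \<rat>. poly h \<theta> = \<alpha> i" if "i \<in> {1..m}" for i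
  proof -
    have "\<alpha> i \<in> K" using that subset_Q_adjoin[of "\<alpha> ` {1..m}"] K by auto
    then show ?thesis unfolding K\<theta> Q_adjoin_singleton[OF \<theta>] by auto
  qed
  then obtain g where g: "\<And>i. i \<in> {1..m} \<Longrightarrow> g i \<in> poly_over \<rat>"
    and g\<alpha>: "\<And>i. i \<in> {1..m} \<Longrightarrow> poly (g i) \<theta> = \<alpha> i"
    by metis
  define lc where "lc = (\<lambda>i. lead_coeff (min_int_poly (\<alpha> i)))"
  have lc: "lc i > 0" if "i \<in> {1..m}" for i
    using is_min_int_poly_min_int_poly[OF alg[OF that]] by (simp add: lc_def is_min_int_poly_def)
  \<comment> \<open>Here \<open>k = d / \<delta> i\<close> is the degree of \<open>K\<close> over
    \<rat>(\<alpha> i). The power of the minimal polynomial lets all generators be expressed over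
    the same \<open>d\<close> conjugates of \<theta>.\<close>
  have "\<exists>k. k * \<delta> i = d \<and> of_int_poly (min_int_poly (\<alpha> i) ^ k) =
      Polynomial.smult (of_int (lc i ^ k)) (\<Prod>z\<in>R. [:- poly (g i) z, 1:])" if i: "i \<in> {1..m}" for i
    using min_int_poly_power_eq_norm[OF \<theta> f g[OF i]] unfolding g\<alpha>[OF i] deg[OF i] df lc_def R_def
    by metis
  then obtain k where k: "\<And>i. i \<in> {1..m} \<Longrightarrow> k i * \<delta> i = d"
    and norm: "\<And>i. i \<in> {1..m} \<Longrightarrow> of_int_poly (min_int_poly (\<alpha> i) ^ k i) =
      Polynomial.smult (of_int (lc i ^ k i)) (\<Prod>z\<in>R. [:- poly (g i) z, 1:])"
    by metis
  define b where "b = d div 2"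
  have b: "b \<ge> 1"
  proof -
    \<comment> \<open>Since \<open>\<delta> 1\<close> is at least 2 and divides the positive
      \<open>d\<close>, also \<open>d \<ge> 2\<close>; this makes the factor \<open>m * b\<close> at
      least 1.\<close>
    have "k 1 * \<delta> 1 = d" "\<delta> 1 \<ge> 2" using k[of 1] deg_ge[of 1] m by auto
    then have "d \<ge> 2" using d0 by (cases "k 1") auto
    then show ?thesis by (simp add: b_def)
  qed

  have "(\<lambda>i. poly (g i) \<theta>) ` {1..m} = \<alpha> ` {1..m}" using g\<alpha> by auto
  then have gen\<theta>: "Q_adjoin ((\<lambda>i. poly (g i) \<theta>) ` {1..m}) = Q_adjoin {\<theta>}" using K K\<theta> by simp
  obtain c where "\<forall>i\<in>{1..m}. \<bar>c i\<bar> \<le> int (degree f div 2)"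
    and gen: "Q_adjoin {\<Sum>i=1..m. of_int (c i) * poly (g i) \<theta>} = Q_adjoin {\<theta>}"
    using ex_generating_linear_combination[where m = m and g = g, OF \<theta> f g gen\<theta>] by blast
  then have c: "\<bar>c i\<bar> \<le> int b" if "i \<in> {1..m}" for i using that by (simp add: df b_def)
  define G where "G = (\<Sum>i=1..m. Polynomial.smult (of_int (c i)) (g i))"
  define \<beta> where "\<beta> = poly G \<theta>"
  have G: "G \<in> poly_over \<rat>"
    unfolding G_def using g
    by (intro is_subring_sum is_subring_poly_over poly_over_smult is_subring_Rats) auto
  have polyG: "poly G z = (\<Sum>i=1..m. of_int (c i) * poly (g i) z)" for z
    by (simp add: G_def poly_sum)
  have K\<beta>: "K = Q_adjoin {\<beta>}" using gen K\<theta> by (simp add: \<beta>_def polyG)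
  have \<beta>: "algebraic \<beta>" unfolding \<beta>_def by (rule algebraic_poly[OF \<theta> G])
  have d\<beta>: "alg_degree \<beta> = d" using Q_degree_Q_adjoin_singleton[OF \<beta>] d K\<beta> by simp
  obtain q where q: "is_min_poly \<rat> q \<beta>" using ex_is_min_poly_Rats[OF \<beta>] by blast
  have dq: "degree q = d" using alg_degree_eq_degree[OF \<beta> q] d\<beta> by simp
  \<comment> \<open>\<beta> generates \<open>K\<close>, so both degrees are \<open>d\<close> and the
    exponent of \<open>q\<close> in the norm is 1.\<close>
  have normG: "(\<Prod>z\<in>R. [:- poly G z, 1:]) = q"
    using norm_eq_power_of_min_poly[OF f G q[unfolded \<beta>_def]] dq df d0 by (auto simp: R_def)

  \<comment> \<open>The finite part of the bound: the factor \<open>lc i ^ k i\<close> makes every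
    subproduct of the conjugates of \<alpha> i integral.\<close>
  define N where "N = (\<Prod>i=1..m. lc i ^ k i)"
  have N: "N > 0" unfolding N_def using lc by (intro prod_pos) auto
  have "algebraic_int (of_int (lc i ^ k i) * (\<Prod>z\<in>T. poly (g i) z))"
    if "i \<in> {1..m}" "T \<subseteq> R" for i T
  proof (rule algebraic_int_prod_subset_roots[OF fin that(2)])
    show "Polynomial.smult (of_int (lc i ^ k i)) (\<Prod>z\<in>R. [:- poly (g i) z, 1:]) \<in> poly_over {x. algebraic_int x}"
      unfolding norm[OF that(1), symmetric] by (rule poly_over_of_int_poly[OF is_subring_algebraic_int])
  qed
  from norm_linear_combination_integral[where c = c, OF fin this]
  have "Polynomial.smult (of_int N) q \<in> poly_over {x. algebraic_int x}"
    unfolding normG[symmetric] polyG N_def of_int_prod .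
  then have leN: "lead_coeff (min_int_poly \<beta>) \<le> N"
    by (rule lead_coeff_min_int_poly_le[OF \<beta> q N])

  define L where "L = real (m * b)"
  have L: "L \<ge> 1" using m b by (simp add: L_def Suc_le_eq flip: of_nat_mult)
  \<comment> \<open>The formula for powers is applied with exponent 1, because the norm of
    \<open>X - \<beta>\<close> is \<open>q\<close> itself.\<close>
  have "alg_mahler \<beta> ^ 1 = of_int (lead_coeff (min_int_poly \<beta>) ^ 1) * (\<Prod>z\<in>R. max 1 (cmod (poly G z)))"
    using min_int_poly_eq_smult[OF \<beta> q] normG by (intro alg_mahler_power_eq[OF fin _ \<beta>]) simp
  then have "alg_mahler \<beta> = of_int (lead_coeff (min_int_poly \<beta>)) * (\<Prod>z\<in>R. max 1 (cmod (poly G z)))"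
    by simp
  also have "\<dots> \<le> of_int N * (\<Prod>z\<in>R. L * (\<Prod>i=1..m. max 1 (cmod (poly (g i) z))))"
  proof (intro mult_mono prod_mono conjI)
    show "max 1 (cmod (poly G z)) \<le> L * (\<Prod>i=1..m. max 1 (cmod (poly (g i) z)))" for z
      unfolding polyG L_def by (rule max_norm_linear_combination_le[OF m b c])
  qed (use leN N in \<open>auto intro!: prod_nonneg\<close>)
  \<comment> \<open>Each of the \<open>d\<close> conjugates contributes one factor \<open>L\<close>;
    exchanging the two products reunites each leading coefficient with the conjugates of its
    \<alpha> i.\<close>
  also have "\<dots> = L ^ d * (\<Prod>i=1..m. of_int (lc i ^ k i) * (\<Prod>z\<in>R. max 1 (cmod (poly (g i) z))))"
    unfolding prod.distrib N_def of_int_prod prod.swap[of _ "{1..m}" R]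
    by (simp add: cardR)
  also have "(\<Prod>i=1..m. of_int (lc i ^ k i) * (\<Prod>z\<in>R. max 1 (cmod (poly (g i) z)))) =
      (\<Prod>i=1..m. alg_mahler (\<alpha> i) powr (real d / real (\<delta> i)))"
  proof (rule prod.cong[OF refl])
    fix i assume i: "i \<in> {1..m}"
    have "of_int (lc i ^ k i) * (\<Prod>z\<in>R. max 1 (cmod (poly (g i) z))) = alg_mahler (\<alpha> i) ^ k i"
      using alg_mahler_power_eq[OF fin norm[OF i, unfolded lc_def] alg[OF i]] by (simp add: lc_def)
    moreover have "real d / real (\<delta> i) = real (k i)"
      using deg_ge[OF i] by (simp flip: k[OF i])
    ultimately show "of_int (lc i ^ k i) * (\<Prod>z\<in>R. max 1 (cmod (poly (g i) z))) =
        alg_mahler (\<alpha> i) powr (real d / real (\<delta> i))"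
      using alg_mahler_ge_1[OF alg[OF i]] by (simp add: powr_realpow)
  qed
  finally have mahler: "alg_mahler \<beta> \<le> L ^ d * (\<Prod>i=1..m. alg_mahler (\<alpha> i) powr (real d / real (\<delta> i)))" .

  have pos: "alg_mahler (\<alpha> i) > 0" if "i \<in> {1..m}" for i using alg_mahler_ge_1[OF alg[OF that]] by simp
  \<comment> \<open>The height bound is the logarithm of the Mahler bound divided by
    \<open>d\<close>, which is the degree of \<beta>.\<close>
  have "ln (alg_mahler \<beta>) \<le> ln (L ^ d * (\<Prod>i=1..m. alg_mahler (\<alpha> i) powr (real d / real (\<delta> i))))"
    using mahler alg_mahler_ge_1[OF \<beta>] by (intro ln_mono) auto
  also have "\<dots> = real d * ln L + (\<Sum>i=1..m. ln (alg_mahler (\<alpha> i) powr (real d / real (\<delta> i))))"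
  proof -
    have P: "alg_mahler (\<alpha> i) powr (real d / real (\<delta> i)) > 0" if "i \<in> {1..m}" for i
      using pos[OF that] by simp
    then have "ln (\<Prod>i=1..m. alg_mahler (\<alpha> i) powr (real d / real (\<delta> i))) =
        (\<Sum>i=1..m. ln (alg_mahler (\<alpha> i) powr (real d / real (\<delta> i))))"
      by (intro ln_prod) auto
    moreover have "(\<Prod>i=1..m. alg_mahler (\<alpha> i) powr (real d / real (\<delta> i))) > 0"
      by (rule prod_pos[OF P])
    moreover have "L ^ d > 0" "ln (L ^ d) = real d * ln L" using L by (simp_all add: ln_realpow)
    ultimately show ?thesis by (simp only: ln_mult_pos)
  qed
  also have "(\<Sum>i=1..m. ln (alg_mahler (\<alpha> i) powr (real d / real (\<delta> i)))) =
      real d * (\<Sum>i=1..m. log_height (\<alpha> i))"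
    unfolding sum_distrib_left
  proof (rule sum.cong[OF refl])
    fix i assume i: "i \<in> {1..m}"
    show "ln (alg_mahler (\<alpha> i) powr (real d / real (\<delta> i))) = real d * log_height (\<alpha> i)"
      using pos[OF i] by (simp add: ln_powr log_height_def deg[OF i])
  qed
  finally have "ln (alg_mahler \<beta>) / real d \<le> ln L + (\<Sum>i=1..m. log_height (\<alpha> i))"
    using d0 by (simp add: field_simps)
  then have "log_height \<beta> \<le> ln L + (\<Sum>i=1..m. log_height (\<alpha> i))"
    by (simp add: log_height_def d\<beta>)
  moreover have "\<beta> \<in> K" using K\<beta> subset_Q_adjoin[of "{\<beta>}"] by simp
  ultimately show ?thesis
    using \<beta> K\<beta> mahler unfolding L_def b_def by blast
qed

end
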